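(* Let $n$ be fixed and let $$C(z)\in\mathbb{C}^{n\times n}[z],\qquad A_N(z):=P_NC(z)Q_N\in\mathbb{C}^{N\times N}[z],$$ be deterministic matrix polynomials, where $P_N\in\mathbb{C}^{N\times n}$, $Q_N\in\mathbb{C}^{n\times N}$, $N=1,2,\dots$. Let $X_N(z)\in\mathbb{C}^{N\times N}[z]$ be a random matrix polynomial. Assume that (a1) the resolvent $X_N(z)^{-1}$ has a limit law $M_N(z)$ on a family of sets $\mathbf{S}_N$ with the rate $\Psi_N(z)$; (a2.1) $C(z)$ is invertible for $z\in\bigcup_N\mathbf{S}_N$; (a3.1) $\sup_{z\in\mathbf{S}_N}|\Psi_N(z)|\le\mathcal{O}(N^{-\alpha})$ with some $\alpha>0$; (a4) $\|P_N\|_2,\ \|Q_N\|_2,\ c(P_N),\ r(Q_N)$ are bounded by a constant independent of $N$; (a5.1) the matrix-valued function $z\mapsto Q_NM_N(z)P_N$ is analytic on the interior of $\bigcup_N\mathbf{S}_N$ and does not depend on $N$. Let $$K(z):=C(z)^{-1}+Q_NM_N(z)P_N,\qquad L_N(z):=C(z)^{-1}+Q_NX_N(z)^{-1}P_N .$$ Assume that the function $\det K(z)$ has a zero of order $k>0$ at a point $z_0$ lying in the interior of $\bigcup_N\mathbf{S}_N$, and let $\lambda_1^N,\dots,\lambda_k^N,\dots$ be the zeros of $\det L_N(z)$ written down with multiplicities in the order given by their distance to $z_0$. Then the first $k$ of them converge to $z_0$ in the sense that $$|\lambda_j^N-z_0|\prec N^{-\frac{\alpha}{k}},\qquad j=1,2,\dots,k,$$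 while the $(k+1)$-st, and in consequence all following ones, do not converge to $z_0$; more precisely, for any $\beta>0$ the family of random variables $|\lambda_{k+1}^N-z_0|$ is not simultaneously stochastically dominated by $N^{-\beta}$.
   Context: Norms. For a matrix $A$, $\|A\|_2$ is the operator norm induced by the Euclidean norm, and $\|A\|_{\max}$ is the maximum of the absolute values of its entries. $r(B)$ denotes the maximal number of nonzero entries in a row of $B$, and $c(B)$ the maximal number of nonzero entries in a column of $B$. Matrix polynomials. For $X(z)=\sum_{j=0}^k z^jX^{(j)}$ with $X^{(j)}\in\mathbb{C}^{N\times N}$, a point $\lambda\in\mathbb{C}$ is an eigenvalue if $X(\lambda)x=0$ for some nonzero $x\in\mathbb{C}^N$. $X$ is regular if $\det X(z)$ is not identically zero; then the resolvent is $X(z)^{-1}=\left(\sum_j z^jX^{(j)}\right)^{-1}$, a matrix-valued rational function. Eigenvalues and resolvents are considered only for regular polynomials with invertible leading coefficient. A random matrix polynomial $X_N(z)=\sum_{i} z^iX_N^{(i)}$ has coefficients that are deterministic or random matrices, with degree fixed and independent of $N$. All random objects live on one probability space. Stochastic domination. Let $\xi=\{\xi^{(N)}(u):N\in\mathbb{N},u\in U^{(N)}\}$ and $\zeta=\{\zeta^{(N)}(u):N\in\mathbb{N},u\in U^{(N)}\}$ be families of nonnegative random variables ($U^{(N)}$ a possibly $N$-dependent parameter set, possibly a single point). $\xi$ is stochastically dominated by $\zeta$ simultaneously in $u$, written $\xi\prec\zeta$, if for all $\varepsilon>0$ and $\gamma>0$ $$\mathbb{P}\Big(\bigcap_{u\in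 U^{(N)}}\{\xi^{(N)}(u)\le N^{\varepsilon}\zeta^{(N)}(u)\}\Big)\ge 1-N^{-\gamma}$$ for all $N\ge N_0(\varepsilon,\gamma)$. An $N$-dependent event holds with high probability if for every $\gamma>0$ its probability is at least $1-N^{-\gamma}$ for $N\ge N_0(\gamma)$. Limit law. Let $\mathbf{S}_N\subset\mathbb{C}$ be deterministic open sets with $\mathbf{S}_N\subset\mathbf{S}_{N+1}$, and let $M_N:\mathbf{S}_N\to\mathbb{C}^{N\times N}$ and $\Psi_N:\mathbf{S}_N\to[0,+\infty]$ be deterministic functions such that $(\Psi_N(z))_N$ converges to zero for every $z\in\bigcup_N\mathbf{S}_N$. The resolvent $X_N(z)^{-1}$ has the limit law $M_N(z)$ on the sets $\mathbf{S}_N$ with the rate $\Psi_N(z)$ if (i) the event {no eigenvalue of $X_N(z)$ lies in $\mathbf{S}_N$} holds with high probability, and (ii) $\|X_N(z)^{-1}-M_N(z)\|_{\max}\prec\Psi_N(z)$ simultaneously in $z\in\mathbf{S}_N$. Ordering. Given $z_0\in\mathbb{C}$, the points of the complex plane are ordered by the lexicographic order on $[0,+\infty)\times[0,2\pi)$, identifying $\lambda$ with $(|\lambda-z_0|,\arg(\lambda-z_0))$. *)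

theory Defs
  imports
    "HOL-Probability.Probability"
    "HOL-Complex_Analysis.Complex_Analysis"
    "Jordan_Normal_Form.Determinant"
    "Jordan_Normal_Form.Gauss_Jordan_Elimination"
begin

text \<open>
  Since the matrix size \<open>N\<close> varies inside the statement, matrices are those of
  \<open>Jordan_Normal_Form\<close>, with explicit dimensions; \<open>det\<close> is \<open>Determinant.det\<close>.
\<close>

hide_const (open) Determinants.det


subsection \<open>Norms and counts of nonzero entries\<close>

definition vec_norm2 :: "complex Matrix.vec \<Rightarrow> real" where
  "vec_norm2 x = L2_set (\<lambda>i. cmod (vec_index x i)) {..<dim_vec x}"

text \<open>
  As in \<open>onorm\<close>, the quotient at \<open>x = 0\<close> is \<open>0\<close>, so the supremum is over a nonempty bounded set.
\<close>

definition mat_norm2 :: "complex mat \<Rightarrow> real" where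
  "mat_norm2 A = (SUP x\<in>carrier_vec (dim_col A). vec_norm2 (A *\<^sub>v x) / vec_norm2 x)"

text \<open>Inserting \<open>0\<close> in the maxima below only matters for empty matrices.\<close>

definition mat_norm_max :: "complex mat \<Rightarrow> real" where
  "mat_norm_max A = Max (insert 0 (cmod ` elements_mat A))"

definition row_nonzeros :: "complex mat \<Rightarrow> nat" where
  "row_nonzeros B = Max (insert 0 ((\<lambda>i. card {j. j < dim_col B \<and> B $$ (i, j) \<noteq> 0}) ` {..<dim_row B}))"

definition col_nonzeros :: "complex mat \<Rightarrow> nat" where
  "col_nonzeros B = Max (insert 0 ((\<lambda>j. card {i. i < dim_row B \<and> B $$ (i, j) \<noteq> 0}) ` {..<dim_col B}))"


subsection \<open>Matrix polynomials\<close>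

text \<open>
  A matrix polynomial \<open>X(z) = (\<Sum>l. z ^ l X\<^sub>l)\<close> is represented by the matrix of its entries, which are
  scalar polynomials; \<open>mpoly_coeff X l\<close> recovers the matrix \<open>X\<^sub>l\<close>.
\<close>

definition mpoly_eval :: "complex poly mat \<Rightarrow> complex \<Rightarrow> complex mat" where
  "mpoly_eval X z = map_mat (\<lambda>p. poly p z) X"

definition mpoly_coeff :: "complex poly mat \<Rightarrow> nat \<Rightarrow> complex mat" where
  "mpoly_coeff X l = map_mat (\<lambda>p. coeff p l) X"

definition mpoly_const :: "complex mat \<Rightarrow> complex poly mat" where
  "mpoly_const B = map_mat (\<lambda>c. [:c:]) B"

definition mpoly_eigenvalue :: "complex poly mat \<Rightarrow> complex \<Rightarrow> bool" where
  "mpoly_eigenvalue X w \<longleftrightarrow>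
     (\<exists>x\<in>carrier_vec (dim_col X). x \<noteq> 0\<^sub>v (dim_col X) \<and> mpoly_eval X w *\<^sub>v x = 0\<^sub>v (dim_row X))"

text \<open>Unspecified at the points where the matrix is singular.\<close>

definition resolvent :: "complex poly mat \<Rightarrow> complex \<Rightarrow> complex mat" where
  "resolvent X z = the (mat_inverse (mpoly_eval X z))"

definition random_mpoly :: "'w measure \<Rightarrow> nat \<Rightarrow> (nat \<Rightarrow> 'w \<Rightarrow> complex poly mat) \<Rightarrow> bool" where
  "random_mpoly Pr d X \<longleftrightarrow> (\<forall>N\<ge>1.
     (\<forall>w\<in>space Pr. X N w \<in> carrier_mat N N \<and> (\<forall>i<N. \<forall>j<N. degree (X N w $$ (i, j)) \<le> d)) \<and>
     (\<forall>l\<le>d. \<forall>i<N. \<forall>j<N. (\<lambda>w. mpoly_coeff (X N w) l $$ (i, j)) \<in> borel_measurable Pr) \<and>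
     (AE w in Pr. invertible_mat (mpoly_coeff (X N w) d)))"


subsection \<open>Stochastic domination and limit laws\<close>

text \<open>
  \<open>P(A) \<ge> p\<close>, read as inner probability: events such as those below are intersections over uncountable
  parameter sets and need not be measurable a priori. For measurable \<open>A\<close> this is \<open>measure Pr A \<ge> p\<close>.
\<close>

definition prob_at_least :: "'w measure \<Rightarrow> 'w set \<Rightarrow> real \<Rightarrow> bool" where
  "prob_at_least Pr A p \<longleftrightarrow> (\<exists>E\<in>sets Pr. E \<subseteq> A \<and> measure Pr E \<ge> p)"

lemma (in prob_space) prob_at_least_iff:
  assumes "A \<in> events"
  shows "prob_at_least M A p \<longleftrightarrow> prob A \<ge> p"
  using assms finite_measure_mono unfolding prob_at_least_def by (meson order_refl order_trans)

definition with_high_prob :: "'w measure \<Rightarrow> (nat \<Rightarrow> 'w set) \<Rightarrow> bool" where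
  "with_high_prob Pr A \<longleftrightarrow>
     (\<forall>\<gamma>>0. \<exists>N0. \<forall>N\<ge>N0. prob_at_least Pr (A N) (1 - real N powr (-\<gamma>)))"

definition stoch_dominated ::
    "'w measure \<Rightarrow> (nat \<Rightarrow> 'u set) \<Rightarrow> (nat \<Rightarrow> 'u \<Rightarrow> 'w \<Rightarrow> ennreal) \<Rightarrow> (nat \<Rightarrow> 'u \<Rightarrow> 'w \<Rightarrow> ennreal) \<Rightarrow> bool"
  where
  "stoch_dominated Pr U \<xi> \<zeta> \<longleftrightarrow>
     (\<forall>\<epsilon>>0. \<forall>\<gamma>>0. \<exists>N0. \<forall>N\<ge>N0.
        prob_at_least Pr {w\<in>space Pr. \<forall>u\<in>U N. \<xi> N u w \<le> ennreal (real N powr \<epsilon>) * \<zeta> N u w}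
          (1 - real N powr (-\<gamma>)))"

definition has_limit_law ::
    "'w measure \<Rightarrow> (nat \<Rightarrow> 'w \<Rightarrow> complex poly mat) \<Rightarrow> (nat \<Rightarrow> complex \<Rightarrow> complex mat) \<Rightarrow>
     (nat \<Rightarrow> complex set) \<Rightarrow> (nat \<Rightarrow> complex \<Rightarrow> ennreal) \<Rightarrow> bool" where
  "has_limit_law Pr X M S \<Psi> \<longleftrightarrow>
     (\<forall>N\<ge>1. open (S N) \<and> S N \<subseteq> S (Suc N) \<and> (\<forall>z\<in>S N. M N z \<in> carrier_mat N N)) \<and>
     (\<forall>z\<in>(\<Union>N\<in>{1..}. S N). (\<lambda>N. \<Psi> N z) \<longlonglongrightarrow> 0) \<and>
     with_high_prob Pr (\<lambda>N. {w\<in>space Pr. \<forall>z\<in>S N. \<not> mpoly_eigenvalue (X N w) z}) \<and>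
     stoch_dominated Pr S
       (\<lambda>N z w. ennreal (mat_norm_max (resolvent (X N w) z - M N z))) (\<lambda>N z w. \<Psi> N z)"


subsection \<open>Zeros ordered by their distance to a point\<close>

definition dist_arg_le :: "complex \<Rightarrow> complex \<Rightarrow> complex \<Rightarrow> bool" where
  "dist_arg_le z0 a b \<longleftrightarrow>
     cmod (a - z0) < cmod (b - z0) \<or>
     cmod (a - z0) = cmod (b - z0) \<and> Arg2pi (a - z0) \<le> Arg2pi (b - z0)"

text \<open>
  Multiplicity of \<open>w\<close> as a zero of a meromorphic function. As \<open>zorder\<close> only looks at a punctured
  neighbourhood, removable singularities are filled in; non-zeros and poles have multiplicity \<open>0\<close>, and
  so does every point at which the function vanishes identically.
\<close>

definition zero_mult :: "(complex \<Rightarrow> complex) \<Rightarrow> complex \<Rightarrow> nat" where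
  "zero_mult f w = (if \<exists>\<^sub>F z in at w. f z \<noteq> 0 then nat (zorder f w) else 0)"

definition ordered_zeros :: "complex \<Rightarrow> (complex \<Rightarrow> complex) \<Rightarrow> complex list" where
  "ordered_zeros z0 f =
     (THE zs. sorted_wrt (dist_arg_le z0) zs \<and> (\<forall>w. count_list zs w = zero_mult f w))"

text \<open>
  The distance of the \<open>j\<close>-th zero to \<open>z0\<close> (counting from \<open>1\<close>), infinite if there are fewer than
  \<open>j\<close> zeros.
\<close>

definition zero_dist :: "complex \<Rightarrow> (complex \<Rightarrow> complex) \<Rightarrow> nat \<Rightarrow> ennreal" where
  "zero_dist z0 f j =
     (let zs = ordered_zeros z0 f
      in if 1 \<le> j \<and> j \<le> length zs then ennreal (cmod (zs ! (j - 1) - z0)) else \<infinity>)"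

lemma dist_arg_le_linear:
  shows "dist_arg_le z0 a a"
    and "dist_arg_le z0 a b \<or> dist_arg_le z0 b a"
    and "dist_arg_le z0 a b \<Longrightarrow> dist_arg_le z0 b c \<Longrightarrow> dist_arg_le z0 a c"
    and "dist_arg_le z0 a b \<Longrightarrow> dist_arg_le z0 b a \<Longrightarrow> a = b"
proof -
  show "a = b" if "dist_arg_le z0 a b" "dist_arg_le z0 b a"
  proof -
    have "cmod (a - z0) = cmod (b - z0)" "Arg2pi (a - z0) = Arg2pi (b - z0)"
      using that by (auto simp: dist_arg_le_def)
    then have "a - z0 = b - z0"
      using Arg2pi_eq[of "a - z0"] Arg2pi_eq[of "b - z0"] by simp
    then show ?thesis by simp
  qed
qed (auto simp: dist_arg_le_def)

lemma ordered_zeros_unique: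
  assumes "sorted_wrt (dist_arg_le z0) xs" "sorted_wrt (dist_arg_le z0) ys"
    and "\<forall>w. count_list xs w = count_list ys w"
  shows "xs = ys"
  using assms
proof (induction xs arbitrary: ys)
  case Nil
  then show ?case
    by (cases ys) (auto dest: spec[of _ "hd ys"])
next
  case (Cons x xs)
  have sets: "set (x # xs) = set ys"
    using Cons.prems(3) by (metis count_list_0_iff subsetI subset_antisym)
  then obtain y ys' where ys: "ys = y # ys'"
    by (cases ys) auto
  have "x = y"
  proof (rule dist_arg_le_linear(4))
    show "dist_arg_le z0 x y"
      using Cons.prems(1) sets ys by (metis dist_arg_le_linear(1) list.set_intros(1) set_ConsD sorted_wrt.simps(2))
    show "dist_arg_le z0 y x"
      using Cons.prems(2) sets ys by (metis dist_arg_le_linear(1) list.set_intros(1) set_ConsD sorted_wrt.simps(2))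
  qed
  moreover have "xs = ys'"
  proof (rule Cons.IH)
    show "\<forall>w. count_list xs w = count_list ys' w"
      using Cons.prems(3) ys \<open>x = y\<close> by (metis add_right_cancel count_list.simps(2))
  qed (use Cons.prems ys in auto)
  ultimately show ?case using ys by simp
qed

lemma ordered_zeros_eqI:
  assumes "sorted_wrt (dist_arg_le z0) zs" "\<And>w. count_list zs w = zero_mult f w"
  shows "ordered_zeros z0 f = zs"
  unfolding ordered_zeros_def
  by (rule the_equality) (use assms ordered_zeros_unique in auto)

end

theory Submission
  imports Defs
begin

text \<open>
  On the high-probability event that \<open>X\<^sub>N\<close> has no eigenvalue in \<open>S\<^sub>N\<close> and the limit law holds with an
  \<open>N\<^sup>e\<close> loss, sparsity of \<open>P\<^sub>N\<close> and \<open>Q\<^sub>N\<close> turns the entrywise bound on \<open>X\<^sub>N\<^sup>-\<^sup>1 - M\<^sub>N\<close> into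
  \<open>\<bar>det L\<^sub>N - det K\<bar> \<le> c N\<^bsup>e - \<alpha>\<^esup>\<close> on a fixed disc around \<open>z\<^sub>0\<close>. There \<open>\<bar>det K(z)\<bar> \<ge> a \<bar>z - z\<^sub>0\<bar>\<^sup>k\<close>, so
  Rouche's theorem yields exactly \<open>k\<close> zeros of \<open>det L\<^sub>N\<close> in every disc of radius \<open>\<rho>\<close> with
  \<open>a \<rho>\<^sup>k > c N\<^bsup>e - \<alpha>\<^esup>\<close>: taking \<open>\<rho>\<close> slightly larger than \<open>N\<^bsup>-\<alpha>/k\<^esup>\<close> bounds the first \<open>k\<close> distances, and
  taking \<open>\<rho>\<close> constant bounds the next one away from \<open>0\<close>.
\<close>

subsection \<open>Zeros ordered by distance\<close>

text \<open>Insertion into a sorted list: \<open>a\<close> is placed after the elements related to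
  it, and totality relates it to all the others. This supplies the existence half for
  \<open>ordered_zeros\<close>.\<close>

lemma exists_sorted_wrt:
  assumes "\<And>a b. R a b \<or> R b a" "\<And>a b c. R a b \<Longrightarrow> R b c \<Longrightarrow> R a c"
  shows "\<exists>ys. mset ys = mset xs \<and> sorted_wrt R ys"
proof (induction xs)
  case (Cons a xs)
  then obtain ys where ys: "mset ys = mset xs" "sorted_wrt R ys"
    by blast
  let ?zs = "filter (\<lambda>x. R x a) ys @ a # filter (\<lambda>x. \<not> R x a) ys"
  have "sorted_wrt R ?zs"
    using ys(2) assms(1) by (auto simp: sorted_wrt_append sorted_wrt_filter intro: assms(2)[of _ a])
  moreover have "mset ?zs = mset (a # xs)"
    using ys(1) by (simp add: multiset_partition[symmetric])
  ultimately show ?case by blast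
qed simp

text \<open>This discharges the definite description. Finite support makes
  \<open>zero_mult f\<close> the counting function of a multiset, any listing of which can be
  sorted; uniqueness is \<open>ordered_zeros_eqI\<close>.\<close>

lemma ordered_zeros:
  assumes "finite {w. zero_mult f w \<noteq> 0}"
  shows "sorted_wrt (dist_arg_le z0) (ordered_zeros z0 f)"
    and "count_list (ordered_zeros z0 f) w = zero_mult f w"
proof -
  obtain xs where xs: "mset xs = Abs_multiset (zero_mult f)"
    using ex_mset by blast
  obtain ys where ys: "mset ys = mset xs" "sorted_wrt (dist_arg_le z0) ys"
    using exists_sorted_wrt[of "dist_arg_le z0" xs] dist_arg_le_linear by metis
  have "count_list ys w = zero_mult f w" for w
  proof -
    have "count_list ys w = count (Abs_multiset (zero_mult f)) w"
      by (simp add: ys(1) xs flip: count_mset)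
    also have "\<dots> = zero_mult f w"
      using assms by (subst count_Abs_multiset) auto
    finally show ?thesis .
  qed
  then show "sorted_wrt (dist_arg_le z0) (ordered_zeros z0 f)"
    and "count_list (ordered_zeros z0 f) w = zero_mult f w"
    using ys(2) ordered_zeros_eqI[of z0 ys f] by auto
qed

lemma length_filter_eq_sum_count_list:
  "length (filter p xs) = (\<Sum>x | x \<in> set xs \<and> p x. count_list xs x)"
proof -
  have "length (filter p xs) = (\<Sum>x\<in>set (filter p xs). count_list (filter p xs) x)"
    by (simp add: sum_count_set)
  also have "\<dots> = (\<Sum>x | x \<in> set xs \<and> p x. count_list xs x)"
    by (intro sum.cong) (auto simp: count_list_eq_length_filter filter_filter intro!: arg_cong[where f = length] filter_cong)
  finally show ?thesis .
qed

text \<open>Distances increase along the list, so the indices of the zeros in the open disc form an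
  initial segment, of length \<open>k\<close> by the count. Later zeros lie outside the disc or are
  missing, in which case \<open>zero_dist\<close> is infinite.\<close>

lemma zero_dist_bounds:
  assumes fin: "finite {w. zero_mult f w \<noteq> 0}"
    and count: "(\<Sum>w | zero_mult f w \<noteq> 0 \<and> cmod (w - z0) < \<rho>. zero_mult f w) = k"
  shows "j \<in> {1..k} \<Longrightarrow> zero_dist z0 f j \<le> ennreal \<rho>"
    and "k < j \<Longrightarrow> ennreal \<rho> \<le> zero_dist z0 f j"
proof -
  define zs where "zs = ordered_zeros z0 f"
  define I where "I = {i. i < length zs \<and> cmod (zs ! i - z0) < \<rho>}"
  have sorted: "cmod (zs ! i - z0) \<le> cmod (zs ! l - z0)" if "i \<le> l" "l < length zs" for i l
  proof (cases "i = l")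
    case False
    then have "dist_arg_le z0 (zs ! i) (zs ! l)"
      using ordered_zeros(1)[OF fin, of z0] that by (auto simp: zs_def sorted_wrt_iff_nth_less)
    then show ?thesis by (auto simp: dist_arg_le_def)
  qed simp
  have supp: "w \<in> set zs \<longleftrightarrow> zero_mult f w \<noteq> 0" for w
    using ordered_zeros(2)[OF fin] count_list_0_iff zs_def by metis
  have "card I = length (filter (\<lambda>w. cmod (w - z0) < \<rho>) zs)"
    by (simp add: I_def length_filter_conv_card)
  also have "\<dots> = k"
    using count ordered_zeros(2)[OF fin]
    by (simp add: length_filter_eq_sum_count_list supp) (simp add: zs_def)
  finally have card: "card I = k" .
  have "finite I" by (simp add: I_def)
  show "zero_dist z0 f j \<le> ennreal \<rho>" if j: "j \<in> {1..k}"
  proof -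
    \<comment> \<open>\<open>zero_dist\<close> counts from 1 and list positions from 0. If position
      \<open>j - 1\<close> were outside \<open>I\<close>, then so would be all later ones, leaving
      fewer than \<open>j\<close> indices.\<close>
    have "j - 1 \<in> I"
    proof (rule ccontr)
      assume n: "j - 1 \<notin> I"
      have "I \<subseteq> {..<j - 1}"
      proof
        fix i assume i: "i \<in> I"
        have False if "j - 1 \<le> i"
          using sorted[OF that] i n that by (auto simp: I_def)
        then show "i \<in> {..<j - 1}" by (meson lessThan_iff not_le)
      qed
      then have "card I \<le> j - 1"
        using card_mono[of "{..<j - 1}" I] by simp
      then show False using card j by auto
    qed
    then show ?thesis using j
      by (auto simp: zero_dist_def Let_def I_def zs_def[symmetric] intro!: ennreal_leI)
  qed
  show "ennreal \<rho> \<le> zero_dist z0 f j" if j: "k < j"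
  proof (cases "j \<le> length zs")
    case True
    have "\<not> cmod (zs ! (j - 1) - z0) < \<rho>"
    proof
      assume a: "cmod (zs ! (j - 1) - z0) < \<rho>"
      have "{..<j} \<subseteq> I"
      proof
        fix i assume "i \<in> {..<j}"
        then show "i \<in> I"
          using sorted[of i "j - 1"] a True by (simp add: I_def) linarith
      qed
      then have "j \<le> card I" using card_mono[OF \<open>finite I\<close>, of "{..<j}"] by simp
      then show False using card j by simp
    qed
    then show ?thesis using j True
      by (auto simp: zero_dist_def Let_def zs_def[symmetric] intro!: ennreal_leI)
  next
    case False
    then show ?thesis by (simp add: zero_dist_def Let_def zs_def[symmetric])
  qed
qed

section \<open>Multiplicities of zeros and their count by Rouche's theorem\<close>

lemma zero_mult_eq_zorder:
  assumes "f analytic_on {w}" "\<exists>\<^sub>F z in at w. f z \<noteq> 0"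
  shows "int (zero_mult f w) = zorder f w" "zero_mult f w \<noteq> 0 \<longleftrightarrow> f w = 0"
  using assms(2) zorder_ge_0[OF assms] zorder_pos_iff'[OF assms] by (auto simp: zero_mult_def not_le)

text \<open>
  Without finiteness of the support of \<open>zero_mult f\<close> the list \<open>ordered_zeros z0 f\<close> would be
  unspecified; for quotients of polynomials the lemma below places the support among the roots of
  the numerator, even though \<open>f\<close> may take arbitrary values at the roots of the denominator.
\<close>

lemma zero_mult_quotient_eq_0:
  assumes f: "\<And>z. poly q z \<noteq> 0 \<Longrightarrow> f z = poly p z / poly q z"
    and "q \<noteq> 0" "poly p w \<noteq> 0"
  shows "zero_mult f w = 0"
proof -
  let ?h = "\<lambda>z. poly p z / poly q z"
  have nz: "\<forall>\<^sub>F z in at w. poly r z \<noteq> 0" if "r \<noteq> 0" for r :: "complex poly"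
  proof -
    have "\<forall>\<^sub>F z in at w. z \<notin> {z. poly r z = 0}"
      using islimpt_finite[OF poly_roots_finite[OF that]] islimpt_iff_eventually by blast
    then show ?thesis by simp
  qed
  have "p \<noteq> 0" using assms by auto
  note nzp = nz[OF \<open>p \<noteq> 0\<close>] and nzq = nz[OF \<open>q \<noteq> 0\<close>]
  have an: "poly r analytic_on A" for r :: "complex poly" and A
    by (rule analytic_on_subset[of _ UNIV]) (auto simp: analytic_on_open intro!: holomorphic_intros)
  \<comment> \<open>The order only depends on a punctured neighbourhood, which can be chosen free of
    roots of \<open>q\<close>; the value of \<open>f\<close> at \<open>w\<close> itself is
    irrelevant.\<close>
  have "zorder f w = zorder ?h w"
    by (rule zorder_cong) (use nzq f in \<open>auto elim!: eventually_mono\<close>)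
  also have "\<dots> = zorder (poly p) w - zorder (poly q) w"
    by (rule zorder_divide) (use nzp nzq an in \<open>auto intro!: analytic_on_imp_meromorphic_on eventually_frequently\<close>)
  also have "\<dots> \<le> 0"
    using zorder_eq_0I[OF an assms(3)] zorder_ge_0[OF an[of q "{w}"]] nzq
    by (simp add: eventually_frequently)
  finally show ?thesis by (simp add: zero_mult_def)
qed

text \<open>Rouche's theorem for \<open>g\<close> and the perturbation \<open>f - g\<close> on the
  circle of radius \<rho>: the only zero of \<open>g\<close> is \<open>z0\<close>, of order
  \<open>k\<close>, and winding numbers are 1 inside the circle and 0 outside it.\<close>

lemma Rouche_zero_count:
  assumes f: "f holomorphic_on ball z0 r" and g: "g holomorphic_on ball z0 r"
    and g0: "\<And>z. z \<in> ball z0 r \<Longrightarrow> g z = 0 \<longleftrightarrow> z = z0" "zorder g z0 = int k"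
    and fin: "finite {z \<in> ball z0 r. f z = 0}"
    and \<rho>: "0 < \<rho>" "\<rho> < r"
    and close: "\<And>z. z \<in> sphere z0 \<rho> \<Longrightarrow> cmod (f z - g z) < cmod (g z)"
  shows "(\<Sum>w | cmod (w - z0) < \<rho> \<and> f w = 0. zorder f w) = int k"
proof -
  let ?\<gamma> = "circlepath z0 \<rho>"
  have sph: "sphere z0 \<rho> \<subseteq> ball z0 r" using \<rho> by auto
  have out: "winding_number ?\<gamma> z = 0" if "z \<notin> cball z0 \<rho>" for z
    by (rule winding_number_zero_outside[of _ "cball z0 \<rho>"])
      (use that \<rho> in \<open>auto simp: sphere_cball\<close>)
  have zf: "{p \<in> ball z0 r. g p = 0} = {z0}" using g0(1) \<rho> by auto
  have wn: "of_int (zorder f p) * winding_number ?\<gamma> p = (if cmod (p - z0) < \<rho> then of_int (zorder f p) else 0)"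
    if "p \<in> ball z0 r" "f p = 0" for p
  proof -
    \<comment> \<open>A zero of \<open>f\<close> on the circle would turn \<open>close\<close> into
      \<open>cmod (g p) < cmod (g p)\<close>.\<close>
    have "p \<notin> sphere z0 \<rho>" using close[of p] that by auto
    then show ?thesis
      using out[of p] winding_number_circlepath[of p z0 \<rho>] by (auto simp: dist_norm norm_minus_commute)
  qed
  have "(\<Sum>p | p \<in> ball z0 r \<and> g p + (f p - g p) = 0.
            winding_number ?\<gamma> p * of_int (zorder (\<lambda>p. g p + (f p - g p)) p))
      = (\<Sum>p | p \<in> ball z0 r \<and> g p = 0. winding_number ?\<gamma> p * of_int (zorder g p))"
    by (rule Rouche_theorem)
      (use \<rho> sph fin zf close f g out in \<open>auto intro!: holomorphic_intros simp: dist_norm\<close>)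
  then have "(\<Sum>p | p \<in> ball z0 r \<and> f p = 0. of_int (zorder f p) * winding_number ?\<gamma> p) = of_int (int k)"
    using zf g0(2) winding_number_circlepath_centre[OF \<rho>(1)] by (simp add: mult.commute)
  moreover have "(\<Sum>p | p \<in> ball z0 r \<and> f p = 0. of_int (zorder f p) * winding_number ?\<gamma> p)
     = (\<Sum>w | w \<in> ball z0 r \<and> f w = 0 \<and> cmod (w - z0) < \<rho>. of_int (zorder f w))"
    using fin by (intro sum.mono_neutral_cong_right) (auto simp: wn)
  moreover have "{w. w \<in> ball z0 r \<and> f w = 0 \<and> cmod (w - z0) < \<rho>} = {w. cmod (w - z0) < \<rho> \<and> f w = 0}"
    using \<rho> by (auto simp: dist_norm norm_minus_commute)
  ultimately have "of_int (\<Sum>w | cmod (w - z0) < \<rho> \<and> f w = 0. zorder f w) = (of_int (int k) :: complex)"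
    by simp
  then show ?thesis by (simp only: of_int_eq_iff)
qed

text \<open>The global quotient form confines the multiplicities to finitely many points; holomorphy
  on the ball identifies them with orders there, so that the Rouche count applies to the ordered
  list.\<close>

lemma zero_dist_quotient:
  assumes f: "\<And>z. poly q z \<noteq> 0 \<Longrightarrow> f z = poly p z / poly q z"
    and q: "\<And>z. z \<in> ball z0 r \<Longrightarrow> poly q z \<noteq> 0"
    and g: "g holomorphic_on ball z0 r" "\<And>z. z \<in> ball z0 r \<Longrightarrow> g z = 0 \<longleftrightarrow> z = z0"
      "zorder g z0 = int k"
    and \<rho>: "0 < \<rho>" "\<rho> < r"
    and close: "\<And>z. z \<in> sphere z0 \<rho> \<Longrightarrow> cmod (f z - g z) < cmod (g z)"
  shows "j \<in> {1..k} \<Longrightarrow> zero_dist z0 f j \<le> ennreal \<rho>"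
    and "k < j \<Longrightarrow> ennreal \<rho> \<le> zero_dist z0 f j"
proof -
  have "z0 \<in> ball z0 r" using \<rho> by simp
  then have "q \<noteq> 0" using q[of z0] by auto
  \<comment> \<open>Any point of the circle serves: \<open>close\<close> forces \<open>f\<close> to
    be nonzero there, so the numerator \<open>p\<close> is not the zero polynomial.\<close>
  obtain s where s: "s \<in> sphere z0 \<rho>" using \<rho> by (intro that[of "z0 + of_real \<rho>"]) (simp add: dist_norm)
  then have "f s \<noteq> 0" using close[of s] by auto
  moreover have "s \<in> ball z0 r" using s \<rho> by auto
  ultimately have "poly p s \<noteq> 0" using f q by auto
  then have "p \<noteq> 0" by auto
  have f_ball: "f z = poly p z / poly q z" if "z \<in> ball z0 r" for z using f q that by blast
  have hol: "f holomorphic_on ball z0 r"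
    by (subst holomorphic_cong[OF refl f_ball]) (use q in \<open>auto intro!: holomorphic_intros\<close>)
  have fin: "finite {w. zero_mult f w \<noteq> 0}"
    by (rule finite_subset[OF _ poly_roots_finite[OF \<open>p \<noteq> 0\<close>]])
      (metis (mono_tags, lifting) Collect_mono f zero_mult_quotient_eq_0 \<open>q \<noteq> 0\<close>)
  have fin': "finite {z \<in> ball z0 r. f z = 0}"
    by (rule finite_subset[OF _ poly_roots_finite[OF \<open>p \<noteq> 0\<close>]]) (use f_ball q in auto)
  \<comment> \<open>The zeros of \<open>f\<close> in the ball are finite in number, hence isolated,
    and \<open>f\<close> is analytic there.\<close>
  have zm: "int (zero_mult f w) = zorder f w" "zero_mult f w \<noteq> 0 \<longleftrightarrow> f w = 0"
    if "w \<in> ball z0 r" for w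
  proof -
    have an: "f analytic_on {w}" using hol that by (meson analytic_at open_ball)
    have "\<forall>\<^sub>F z in at w. z \<notin> {z \<in> ball z0 r. f z = 0}"
      using islimpt_finite[OF fin'] islimpt_iff_eventually by blast
    moreover have "\<forall>\<^sub>F z in at w. z \<in> ball z0 r"
      using that eventually_at_topological open_ball by blast
    ultimately have "\<forall>\<^sub>F z in at w. f z \<noteq> 0"
      by eventually_elim auto
    then have fr: "\<exists>\<^sub>F z in at w. f z \<noteq> 0" by (simp add: eventually_frequently)
    show "int (zero_mult f w) = zorder f w" "zero_mult f w \<noteq> 0 \<longleftrightarrow> f w = 0"
      using zero_mult_eq_zorder[OF an fr] by auto
  qed
  have inb: "w \<in> ball z0 r" if "cmod (w - z0) < \<rho>" for w
    using that \<rho> by (simp add: dist_norm norm_minus_commute)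
  have "int (\<Sum>w | zero_mult f w \<noteq> 0 \<and> cmod (w - z0) < \<rho>. zero_mult f w)
      = (\<Sum>w | cmod (w - z0) < \<rho> \<and> f w = 0. zorder f w)"
    unfolding of_nat_sum by (rule sum.cong) (use inb zm in auto)
  also have "\<dots> = int k"
    by (rule Rouche_zero_count[OF hol g fin' \<rho> close])
  finally have count: "(\<Sum>w | zero_mult f w \<noteq> 0 \<and> cmod (w - z0) < \<rho>. zero_mult f w) = k"
    by (simp only: of_nat_eq_iff)
  show "j \<in> {1..k} \<Longrightarrow> zero_dist z0 f j \<le> ennreal \<rho>"
    and "k < j \<Longrightarrow> ennreal \<rho> \<le> zero_dist z0 f j"
    using zero_dist_bounds[OF fin count] by auto
qed

subsection \<open>Resolvents as quotients\<close>

text \<open>Evaluation is a ring homomorphism, so it commutes with matrix products and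
  determinants.\<close>

interpretation poly_eval: comm_ring_hom "\<lambda>p. poly p z" for z :: "'a :: comm_ring_1"
  by unfold_locales auto

lemma mpoly_eval_carrier [simp]: "mpoly_eval A z \<in> carrier_mat m n \<longleftrightarrow> A \<in> carrier_mat m n"
  by (simp add: mpoly_eval_def)

lemma mpoly_eval_mult:
  assumes "A \<in> carrier_mat l m" "B \<in> carrier_mat m n"
  shows "mpoly_eval (A * B) z = mpoly_eval A z * mpoly_eval B z"
  unfolding mpoly_eval_def by (rule poly_eval.mat_hom_mult[OF assms])

lemma mpoly_eval_add:
  assumes "A \<in> carrier_mat m n" "B \<in> carrier_mat m n"
  shows "mpoly_eval (A + B) z = mpoly_eval A z + mpoly_eval B z"
  unfolding mpoly_eval_def by (rule eq_matI) (use assms in auto)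

lemma mpoly_eval_smult: "mpoly_eval (p \<cdot>\<^sub>m A) z = poly p z \<cdot>\<^sub>m mpoly_eval A z"
  unfolding mpoly_eval_def by (rule eq_matI) auto

lemma mpoly_eval_const: "mpoly_eval (mpoly_const B) z = B"
  unfolding mpoly_eval_def mpoly_const_def by (rule eq_matI) auto

lemma det_mpoly_eval: "det (mpoly_eval A z) = poly (det A) z"
  unfolding mpoly_eval_def by (rule poly_eval.hom_det)

lemma mpoly_eval_adj_mat:
  assumes "A \<in> carrier_mat n n"
  shows "mpoly_eval A z * mpoly_eval (adj_mat A) z = poly (det A) z \<cdot>\<^sub>m 1\<^sub>m n"
proof -
  have "mpoly_eval A z * mpoly_eval (adj_mat A) z = mpoly_eval (det A \<cdot>\<^sub>m 1\<^sub>m n) z"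
    using assms adj_mat[OF assms] by (simp add: mpoly_eval_mult[symmetric])
  also have "\<dots> = poly (det A) z \<cdot>\<^sub>m 1\<^sub>m n"
    by (auto simp: mpoly_eval_smult) (simp add: mpoly_eval_def poly_eval.mat_hom_one)
  finally show ?thesis .
qed

lemma not_mpoly_eigenvalue_iff:
  assumes "A \<in> carrier_mat n n"
  shows "\<not> mpoly_eigenvalue A z \<longleftrightarrow> poly (det A) z \<noteq> 0"
proof -
  have "mpoly_eval A z \<in> carrier_mat n n" "dim_col A = n" "dim_row A = n"
    using assms by auto
  then show ?thesis
    using det_0_iff_vec_prod_zero_field[of "mpoly_eval A z" n]
    unfolding mpoly_eigenvalue_def det_mpoly_eval by metis
qed

lemma invertible_mpoly_eval_imp_det:
  assumes "A \<in> carrier_mat n n" "invertible_mat (mpoly_eval A z)"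
  shows "poly (det A) z \<noteq> 0"
proof -
  let ?A = "mpoly_eval A z"
  have cA: "?A \<in> carrier_mat n n" using assms(1) by simp
  obtain B where B: "?A * B = 1\<^sub>m (dim_row ?A)" "B * ?A = 1\<^sub>m (dim_row B)"
    using assms(2) by (auto simp: invertible_mat_def inverts_mat_def)
  have "dim_col B = n" "dim_row B = n"
    using arg_cong[OF B(1), of dim_col] arg_cong[OF B(2), of dim_col] cA by auto
  then have "det ?A * det B = 1"
    using B(1) cA det_mult[of ?A n B] by auto
  then show ?thesis by (auto simp: det_mpoly_eval)
qed

text \<open>Cramer's rule, which exhibits the resolvent as a matrix of polynomials over the single
  denominator \<open>det A\<close>.\<close>

lemma resolvent_eq_adj_mat:
  assumes A: "A \<in> carrier_mat n n" and nz: "poly (det A) z \<noteq> 0"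
  shows "resolvent A z = inverse (poly (det A) z) \<cdot>\<^sub>m mpoly_eval (adj_mat A) z"
    and "resolvent A z \<in> carrier_mat n n"
proof -
  let ?A = "mpoly_eval A z"
  let ?d = "poly (det A) z"
  let ?J = "mpoly_eval (adj_mat A) z"
  have cA: "?A \<in> carrier_mat n n" and cJ: "?J \<in> carrier_mat n n" using A adj_mat[OF A] by auto
  have "?A \<in> Units (ring_mat TYPE(complex) n undefined)"
    by (rule det_non_zero_imp_unit[OF cA]) (simp add: det_mpoly_eval nz)
  then obtain B where B: "mat_inverse ?A = Some B"
    using mat_inverse(1)[OF cA, where b = undefined] by (cases "mat_inverse ?A") auto
  note BA = mat_inverse(2)[OF cA B]
  \<comment> \<open>The product of \<open>B\<close>, \<open>?A\<close> and the adjugate is evaluated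
    in two ways: the last two factors give \<open>?d\<close> times the identity, the first two give
    the identity.\<close>
  have "?d \<cdot>\<^sub>m B = B * (?d \<cdot>\<^sub>m 1\<^sub>m n)"
    using BA by (simp add: mult_smult_distrib[of B n n "1\<^sub>m n" n] right_mult_one_mat[of B n n])
  also have "\<dots> = (B * ?A) * ?J"
    unfolding mpoly_eval_adj_mat[OF A, symmetric] using BA cA cJ by (intro assoc_mult_mat[symmetric]) auto
  also have "\<dots> = ?J"
    using BA cJ by simp
  finally have "inverse ?d \<cdot>\<^sub>m ?J = inverse ?d \<cdot>\<^sub>m (?d \<cdot>\<^sub>m B)" by simp
  also have "\<dots> = B" using nz by (intro eq_matI) auto
  finally show "resolvent A z = inverse ?d \<cdot>\<^sub>m ?J" "resolvent A z \<in> carrier_mat n n"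
    using B BA by (auto simp: resolvent_def)
qed

lemma add_inverse_smult_mat:
  fixes A B :: "complex mat"
  assumes "A \<in> carrier_mat m n" "B \<in> carrier_mat m n" "a \<noteq> 0" "b \<noteq> 0"
  shows "inverse a \<cdot>\<^sub>m A + inverse b \<cdot>\<^sub>m B = inverse (a * b) \<cdot>\<^sub>m (b \<cdot>\<^sub>m A + a \<cdot>\<^sub>m B)"
proof -
  have "inverse a * u + inverse b * v = inverse (a * b) * (b * u + a * v)" for u v :: complex
    using assms(3,4) by (simp add: field_simps)
  then show ?thesis
    using assms(1,2) by (intro eq_matI) auto
qed

text \<open>By Cramer's rule for \<open>C\<close> and \<open>X\<close>, the matrix is polynomial up
  to the common denominator \<open>det C * det X\<close>; its determinant, of size \<open>n\<close>,
  raises this denominator to the power \<open>n\<close>.\<close>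

lemma det_resolvent_add_quotient:
  assumes C: "C \<in> carrier_mat n n" and X: "X \<in> carrier_mat N N"
    and Q: "Q \<in> carrier_mat n N" and P: "P \<in> carrier_mat N n"
  obtains p where "\<And>z. poly ((det C * det X) ^ n) z \<noteq> 0 \<Longrightarrow>
    det (resolvent C z + Q * resolvent X z * P) = poly p z / poly ((det C * det X) ^ n) z"
proof (cases "n = 0")
  \<comment> \<open>The denominator is now 1, so the formula must hold even where the resolvents are
    unspecified; it does because every determinant of size 0 is 1.\<close>
  case True
  have "det (resolvent C z + Q * resolvent X z * P) = 1" for z
  proof -
    have "resolvent C z + Q * resolvent X z * P \<in> carrier_mat 0 0"
      using P Q True by (intro carrier_matI) auto
    then show ?thesis by (rule det_dim_zero)
  qed
  then show thesis using True by (intro that[of 1]) simp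
next
  case False
  define Y where "Y = det X \<cdot>\<^sub>m adj_mat C + det C \<cdot>\<^sub>m (mpoly_const Q * adj_mat X * mpoly_const P)"
  have const: "mpoly_const Q \<in> carrier_mat n N" "mpoly_const P \<in> carrier_mat N n"
    using Q P by (auto simp: mpoly_const_def)
  have Y: "Y \<in> carrier_mat n n"
    unfolding Y_def using const adj_mat(1)[OF C] adj_mat(1)[OF X]
    by (intro add_carrier_mat smult_carrier_mat mult_carrier_mat[of _ n N]) auto
  show thesis
  proof (rule that[of "det Y"])
    fix z assume "poly ((det C * det X) ^ n) z \<noteq> 0"
    then have nz: "poly (det C) z \<noteq> 0" "poly (det X) z \<noteq> 0" using False by auto
    let ?c = "poly (det C) z" and ?x = "poly (det X) z"
    let ?J = "mpoly_eval (adj_mat C) z" and ?H = "mpoly_eval (adj_mat X) z"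
    have cH: "?H \<in> carrier_mat N N" and cJ: "?J \<in> carrier_mat n n" using adj_mat(1)[OF C] adj_mat(1)[OF X] by simp_all
    have cQH: "Q * ?H \<in> carrier_mat n N" using Q cH by (rule mult_carrier_mat)
    have cQHP: "Q * ?H * P \<in> carrier_mat n n" using cQH P by (rule mult_carrier_mat)
    have "mpoly_eval (mpoly_const Q * adj_mat X * mpoly_const P) z = Q * ?H * P"
      unfolding mpoly_eval_mult[OF mult_carrier_mat[OF const(1) adj_mat(1)[OF X]] const(2)]
        mpoly_eval_mult[OF const(1) adj_mat(1)[OF X]] mpoly_eval_const ..
    moreover have "det C \<cdot>\<^sub>m (mpoly_const Q * adj_mat X * mpoly_const P) \<in> carrier_mat n n"
      using const adj_mat(1)[OF X] by (intro smult_carrier_mat mult_carrier_mat[of _ n N]) auto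
    ultimately have Yz: "mpoly_eval Y z = ?x \<cdot>\<^sub>m ?J + ?c \<cdot>\<^sub>m (Q * ?H * P)"
      unfolding Y_def using adj_mat(1)[OF C]
      by (subst mpoly_eval_add[of _ n n]) (simp_all add: mpoly_eval_smult)
    have "Q * resolvent X z * P = inverse ?x \<cdot>\<^sub>m (Q * ?H * P)"
      unfolding resolvent_eq_adj_mat(1)[OF X nz(2)] mult_smult_distrib[OF Q cH]
      by (rule mult_smult_assoc_mat[OF cQH P])
    then have "resolvent C z + Q * resolvent X z * P = inverse (?c * ?x) \<cdot>\<^sub>m mpoly_eval Y z"
      unfolding resolvent_eq_adj_mat(1)[OF C nz(1)] Yz
      by (simp only: add_inverse_smult_mat[OF cJ cQHP nz])
    moreover have "dim_col (mpoly_eval Y z) = n" using Y by (simp add: mpoly_eval_def)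
    ultimately show "det (resolvent C z + Q * resolvent X z * P)
        = poly (det Y) z / poly ((det C * det X) ^ n) z"
      by (simp only: det_smult det_mpoly_eval poly_power poly_mult) (simp add: field_simps)
  qed
qed

subsection \<open>Matrix norms and determinants\<close>

text \<open>Telescoping: the factors are exchanged one at a time, each exchange costing \<delta>
  times a product of factors bounded by \<open>R\<close>.\<close>

lemma norm_prod_diff_le:
  fixes a b :: "'i \<Rightarrow> complex"
  assumes "finite I" "\<And>i. i \<in> I \<Longrightarrow> cmod (a i) \<le> R" "\<And>i. i \<in> I \<Longrightarrow> cmod (b i) \<le> R"
    and "\<And>i. i \<in> I \<Longrightarrow> cmod (a i - b i) \<le> \<delta>" and "R \<ge> 1" and "\<delta> \<ge> 0"
  shows "cmod (prod a I - prod b I) \<le> real (card I) * R ^ card I * \<delta>"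
  using assms(1-4)
proof (induction I)
  case (insert i I)
  let ?m = "real (card I)" and ?T = "R ^ card I"
  have pa: "cmod (prod a I) \<le> ?T"
    using insert.prems prod_mono[of I "\<lambda>i. cmod (a i)" "\<lambda>_. R"] by (simp add: prod_norm)
  have IH: "cmod (prod a I - prod b I) \<le> ?m * ?T * \<delta>" using insert by simp
  have "prod a (insert i I) - prod b (insert i I)
      = (a i - b i) * prod a I + b i * (prod a I - prod b I)"
    using insert.hyps by (simp add: algebra_simps)
  also have "cmod \<dots> \<le> cmod (a i - b i) * cmod (prod a I) + cmod (b i) * cmod (prod a I - prod b I)"
    by (metis norm_mult norm_triangle_ineq)
  also have "\<dots> \<le> \<delta> * ?T + R * (?m * ?T * \<delta>)"
    using insert.prems pa IH assms(5,6) by (intro add_mono mult_mono) auto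
  \<comment> \<open>\<open>R \<ge> 1\<close> allows a spare factor \<open>R\<close>, giving both
    terms the same power.\<close>
  also have "\<dots> \<le> \<delta> * (R * ?T) + R * (?m * ?T * \<delta>)"
    using assms(5,6) by (intro add_mono mult_left_mono mult_right_mono) (auto simp: mult_le_cancel_right1)
  also have "\<dots> = real (card (insert i I)) * R ^ card (insert i I) * \<delta>"
    using insert.hyps by (simp add: algebra_simps)
  finally show ?case .
qed simp

text \<open>Leibniz formula: \<open>fact n\<close> permutations, each contributing a difference of
  products of \<open>n\<close> entries with a sign of modulus 1.\<close>

lemma norm_det_diff_le:
  fixes A B :: "complex mat"
  assumes A: "A \<in> carrier_mat n n" and B: "B \<in> carrier_mat n n"
    and "\<And>i j. i < n \<Longrightarrow> j < n \<Longrightarrow> cmod (A $$ (i, j)) \<le> R"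
    and "\<And>i j. i < n \<Longrightarrow> j < n \<Longrightarrow> cmod (B $$ (i, j)) \<le> R"
    and "\<And>i j. i < n \<Longrightarrow> j < n \<Longrightarrow> cmod (A $$ (i, j) - B $$ (i, j)) \<le> \<delta>"
    and "R \<ge> 1" "\<delta> \<ge> 0"
  shows "cmod (det A - det B) \<le> fact n * real n * R ^ n * \<delta>"
proof -
  let ?S = "{p. p permutes {0..<n}}"
  have s: "cmod (signof p * x) = cmod x" for p :: "nat \<Rightarrow> nat" and x by (simp add: sign_def)
  have "det A - det B
      = (\<Sum>p\<in>?S. signof p * ((\<Prod>i = 0..<n. A $$ (i, p i)) - (\<Prod>i = 0..<n. B $$ (i, p i))))"
    by (simp add: det_def'[OF A] det_def'[OF B] sum_subtractf algebra_simps)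
  also have "cmod \<dots> \<le> (\<Sum>p\<in>?S. real n * R ^ n * \<delta>)"
  proof (rule order_trans[OF norm_sum sum_mono])
    fix p assume "p \<in> ?S"
    then have p: "p i < n" if "i < n" for i
      using that permutes_in_image[of p "{0..<n}" i] by auto
    show "cmod (signof p * ((\<Prod>i = 0..<n. A $$ (i, p i)) - (\<Prod>i = 0..<n. B $$ (i, p i))))
        \<le> real n * R ^ n * \<delta>"
      using norm_prod_diff_le[of "{0..<n}" "\<lambda>i. A $$ (i, p i)" R "\<lambda>i. B $$ (i, p i)" \<delta>] p assms
      by (simp add: s)
  qed
  also have "\<dots> = fact n * real n * R ^ n * \<delta>"
    using card_permutations[of "{0..<n}" n] by (simp add: mult.assoc)
  finally show ?thesis .
qed

section \<open>Operator norm, maximum norm and sparsity\<close>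

lemma vec_norm2_mult_le:
  "vec_norm2 (A *\<^sub>v x) \<le> (\<Sum>i<dim_row A. \<Sum>j<dim_col A. cmod (A $$ (i, j))) * vec_norm2 x"
  if "x \<in> carrier_vec (dim_col A)"
proof -
  have "cmod (vec_index (A *\<^sub>v x) i) \<le> (\<Sum>j<dim_col A. cmod (A $$ (i, j)) * vec_norm2 x)" if "i < dim_row A" for i
  proof -
    have "vec_index (A *\<^sub>v x) i = (\<Sum>j<dim_col A. A $$ (i, j) * vec_index x j)"
      using that \<open>x \<in> _\<close> by (simp add: scalar_prod_def atLeast0LessThan)
    also have "cmod \<dots> \<le> (\<Sum>j<dim_col A. cmod (A $$ (i, j)) * vec_norm2 x)"
      using \<open>x \<in> _\<close> by (intro order_trans[OF norm_sum sum_mono])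
        (auto simp: norm_mult vec_norm2_def intro!: mult_left_mono member_le_L2_set)
    finally show ?thesis .
  qed
  then have "(\<Sum>i<dim_row A. cmod (vec_index (A *\<^sub>v x) i))
      \<le> (\<Sum>i<dim_row A. \<Sum>j<dim_col A. cmod (A $$ (i, j)) * vec_norm2 x)"
    by (intro sum_mono) auto
  moreover have "vec_norm2 (A *\<^sub>v x) \<le> (\<Sum>i<dim_row A. cmod (vec_index (A *\<^sub>v x) i))"
    unfolding vec_norm2_def by (intro order_trans[OF L2_set_le_sum]) auto
  ultimately show ?thesis by (simp add: sum_distrib_right)
qed

lemma norm_entry_le_mat_norm2:
  assumes "i < dim_row A" "j < dim_col A"
  shows "cmod (A $$ (i, j)) \<le> mat_norm2 A"
proof -
  let ?e = "unit_vec (dim_col A) j :: complex Matrix.vec"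
  let ?c = "\<Sum>i<dim_row A. \<Sum>j<dim_col A. cmod (A $$ (i, j))"
  \<comment> \<open>The supremum defining \<open>mat_norm2\<close> is only informative for a bounded
    set. The sum of the moduli of all entries is a crude bound; vectors of norm 0 contribute the
    quotient 0.\<close>
  have bdd: "bdd_above ((\<lambda>x. vec_norm2 (A *\<^sub>v x) / vec_norm2 x) ` carrier_vec (dim_col A))"
  proof (rule bdd_aboveI2)
    fix x :: "complex Matrix.vec" assume x: "x \<in> carrier_vec (dim_col A)"
    have "vec_norm2 x \<ge> 0" by (simp add: vec_norm2_def)
    moreover have "?c \<ge> 0" by (intro sum_nonneg) auto
    ultimately show "vec_norm2 (A *\<^sub>v x) / vec_norm2 x \<le> ?c"
      using vec_norm2_mult_le[OF x]
      by (cases "vec_norm2 x = 0") (auto simp: field_simps)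
  qed
  \<comment> \<open>The unit vector \<open>?e\<close> is the test vector: its image is the
    \<open>j\<close>-th column, whose norm dominates each of its entries.\<close>
  have "vec_index (A *\<^sub>v ?e) i = A $$ (i, j)"
    using assms by (simp add: scalar_prod_right_unit)
  then have "cmod (A $$ (i, j)) \<le> vec_norm2 (A *\<^sub>v ?e)"
    using assms member_le_L2_set[of "{..<dim_row A}" i "\<lambda>i. cmod (vec_index (A *\<^sub>v ?e) i)"]
    by (simp add: vec_norm2_def)
  moreover have "(\<Sum>i<dim_col A. (cmod (vec_index ?e i))\<^sup>2) = (\<Sum>i\<in>{j}. 1)"
    using assms by (intro sum.mono_neutral_cong_right) auto
  then have "vec_norm2 ?e = 1"
    by (simp add: vec_norm2_def L2_set_def)
  moreover have "vec_norm2 (A *\<^sub>v ?e) / vec_norm2 ?e \<le> mat_norm2 A"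
    unfolding mat_norm2_def by (rule cSUP_upper[OF _ bdd]) simp
  ultimately show ?thesis by simp
qed

lemma norm_entry_le_mat_norm_max:
  assumes "i < dim_row A" "j < dim_col A"
  shows "cmod (A $$ (i, j)) \<le> mat_norm_max A"
proof -
  have "finite (elements_mat A)" by (simp add: elements_mat_def)
  moreover have "A $$ (i, j) \<in> elements_mat A" using assms by (force simp: elements_mat_def)
  ultimately show ?thesis unfolding mat_norm_max_def by (intro Max_ge) auto
qed

text \<open>At most \<open>c\<close> entries of the row are nonzero and each has modulus at most
  \<open>c\<close>. Sparsity thus keeps the row sum bounded however many columns there are.\<close>

lemma sum_norm_row_le:
  assumes "i < dim_row B" "mat_norm2 B \<le> c" "real (row_nonzeros B) \<le> c" "0 \<le> c"
  shows "(\<Sum>j<dim_col B. cmod (B $$ (i, j))) \<le> c\<^sup>2"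
proof -
  let ?J = "{j. j < dim_col B \<and> B $$ (i, j) \<noteq> 0}"
  have "(\<Sum>j<dim_col B. cmod (B $$ (i, j))) = (\<Sum>j\<in>?J. cmod (B $$ (i, j)))"
    by (intro sum.mono_neutral_right) auto
  also have "\<dots> \<le> (\<Sum>j\<in>?J. c)"
    by (intro sum_mono order_trans[OF norm_entry_le_mat_norm2]) (use assms in auto)
  also have "\<dots> = real (card ?J) * c" by simp
  also have "card ?J \<le> row_nonzeros B"
    unfolding row_nonzeros_def using assms(1) by (intro Max_ge) auto
  then have "real (card ?J) * c \<le> c * c"
    using assms by (intro mult_right_mono) auto
  finally show ?thesis by (simp add: power2_eq_square)
qed

lemma sum_norm_col_le:
  assumes "j < dim_col B" "mat_norm2 B \<le> c" "real (col_nonzeros B) \<le> c" "0 \<le> c"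
  shows "(\<Sum>i<dim_row B. cmod (B $$ (i, j))) \<le> c\<^sup>2"
proof -
  let ?I = "{i. i < dim_row B \<and> B $$ (i, j) \<noteq> 0}"
  have "(\<Sum>i<dim_row B. cmod (B $$ (i, j))) = (\<Sum>i\<in>?I. cmod (B $$ (i, j)))"
    by (intro sum.mono_neutral_right) auto
  also have "\<dots> \<le> (\<Sum>i\<in>?I. c)"
    by (intro sum_mono order_trans[OF norm_entry_le_mat_norm2]) (use assms in auto)
  also have "\<dots> = real (card ?I) * c" by simp
  also have "card ?I \<le> col_nonzeros B"
    unfolding col_nonzeros_def using assms(1) by (intro Max_ge) auto
  then have "real (card ?I) * c \<le> c * c"
    using assms by (intro mult_right_mono) auto
  finally show ?thesis by (simp add: power2_eq_square)
qed

text \<open>The maximum norm of \<open>R\<close> factors out of the double sum, leaving an absolute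
  row sum of \<open>Q\<close> and an absolute column sum of \<open>P\<close>, each at most
  \<open>c\<close> squared. The constant is free of \<open>N\<close>.\<close>

lemma norm_sandwich_entry_le:
  assumes Q: "Q \<in> carrier_mat n N" and R: "R \<in> carrier_mat N N" and P: "P \<in> carrier_mat N n"
    and c: "0 \<le> c" "mat_norm2 Q \<le> c" "real (row_nonzeros Q) \<le> c"
      "mat_norm2 P \<le> c" "real (col_nonzeros P) \<le> c"
    and ij: "i < n" "j < n"
  shows "cmod ((Q * R * P) $$ (i, j)) \<le> c ^ 4 * mat_norm_max R"
proof -
  have "(Q * R * P) $$ (i, j) = (\<Sum>b<N. (\<Sum>a<N. Q $$ (i, a) * R $$ (a, b)) * P $$ (b, j))"
    using Q R P ij by (simp add: scalar_prod_def atLeast0LessThan del: assoc_mult_mat)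
  also have "cmod \<dots> \<le> (\<Sum>b<N. (\<Sum>a<N. cmod (Q $$ (i, a)) * mat_norm_max R) * cmod (P $$ (b, j)))"
  proof (rule order_trans[OF norm_sum sum_mono])
    fix b assume "b \<in> {..<N}"
    then have "cmod (\<Sum>a<N. Q $$ (i, a) * R $$ (a, b)) \<le> (\<Sum>a<N. cmod (Q $$ (i, a)) * mat_norm_max R)"
      using R by (intro order_trans[OF norm_sum sum_mono])
        (auto simp: norm_mult intro!: mult_left_mono norm_entry_le_mat_norm_max)
    then show "cmod ((\<Sum>a<N. Q $$ (i, a) * R $$ (a, b)) * P $$ (b, j))
        \<le> (\<Sum>a<N. cmod (Q $$ (i, a)) * mat_norm_max R) * cmod (P $$ (b, j))"
      by (simp add: norm_mult mult_right_mono)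
  qed
  also have "\<dots> = (\<Sum>a<N. cmod (Q $$ (i, a))) * (\<Sum>b<N. cmod (P $$ (b, j))) * mat_norm_max R"
    by (simp add: sum_distrib_left sum_distrib_right mult_ac) (rule sum.swap)
  also have "\<dots> \<le> c\<^sup>2 * c\<^sup>2 * mat_norm_max R"
  proof (intro mult_right_mono mult_mono)
    show "(\<Sum>a<N. cmod (Q $$ (i, a))) \<le> c\<^sup>2"
      using sum_norm_row_le[of i Q c] Q c ij by auto
    show "(\<Sum>b<N. cmod (P $$ (b, j))) \<le> c\<^sup>2"
      using sum_norm_col_le[of j P c] P c ij by auto
    have "finite (elements_mat R)" by (simp add: elements_mat_def)
    then show "0 \<le> mat_norm_max R"
      unfolding mat_norm_max_def by (intro Max_ge) auto
  qed (auto intro: sum_nonneg)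
  finally show ?thesis by (simp add: power_add[symmetric])
qed

subsection \<open>Events of high probability\<close>

text \<open>Inclusion-exclusion for the measurable events inside \<open>A\<close> and
  \<open>B\<close> that witness the inner probabilities.\<close>

lemma prob_at_least_Int:
  assumes "prob_space Pr" "prob_at_least Pr A p" "prob_at_least Pr B q"
  shows "prob_at_least Pr (A \<inter> B) (p + q - 1)"
proof -
  interpret prob_space Pr by fact
  obtain E F where E: "E \<in> events" "E \<subseteq> A" "p \<le> prob E" and F: "F \<in> events" "F \<subseteq> B" "q \<le> prob F"
    using assms(2,3) by (auto simp: prob_at_least_def)
  have "prob (E \<union> F) = prob E + prob F - prob (E \<inter> F)"
    using E(1) F(1) by (simp add: measure_Un3 fmeasurable_eq_sets)
  moreover have "prob (E \<union> F) \<le> 1" by (rule prob_le_1)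
  ultimately have "p + q - 1 \<le> prob (E \<inter> F)" using E F by linarith
  then show ?thesis
    using E F unfolding prob_at_least_def by (intro bexI[of _ "E \<inter> F"]) auto
qed

lemma prob_at_least_mono:
  assumes "prob_at_least Pr A p" "A \<subseteq> B" "q \<le> p"
  shows "prob_at_least Pr B q"
  using assms unfolding prob_at_least_def by (metis order_trans)

lemma with_high_prob_mono:
  assumes "with_high_prob Pr A" "\<forall>\<^sub>F N in sequentially. A N \<subseteq> B N"
  shows "with_high_prob Pr B"
  unfolding with_high_prob_def
proof (intro allI impI)
  fix \<gamma> :: real assume "\<gamma> > 0"
  then obtain N0 where "\<And>N. N \<ge> N0 \<Longrightarrow> prob_at_least Pr (A N) (1 - real N powr (-\<gamma>))"
    using assms(1) unfolding with_high_prob_def by blast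
  moreover obtain N1 where "\<And>N. N \<ge> N1 \<Longrightarrow> A N \<subseteq> B N"
    using assms(2) by (auto simp: eventually_sequentially)
  ultimately show "\<exists>N0. \<forall>N\<ge>N0. prob_at_least Pr (B N) (1 - real N powr (-\<gamma>))"
    by (intro exI[of _ "max N0 N1"]) (auto intro: prob_at_least_mono)
qed

lemma with_high_prob_Int:
  assumes "prob_space Pr" "with_high_prob Pr A" "with_high_prob Pr B"
  shows "with_high_prob Pr (\<lambda>N. A N \<inter> B N)"
  unfolding with_high_prob_def
proof (intro allI impI)
  fix \<gamma> :: real assume "\<gamma> > 0"
  \<comment> \<open>The exponent is raised by 1 so that the two failure bounds add up to at most
    \<open>real N powr (-\<gamma>)\<close> once \<open>N \<ge> 2\<close>.\<close>
  then have "\<gamma> + 1 > 0" by simp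
  obtain N0 where N0: "\<And>N. N \<ge> N0 \<Longrightarrow> prob_at_least Pr (A N) (1 - real N powr (-(\<gamma> + 1)))"
    using assms(2) \<open>\<gamma> + 1 > 0\<close> unfolding with_high_prob_def by blast
  obtain N1 where N1: "\<And>N. N \<ge> N1 \<Longrightarrow> prob_at_least Pr (B N) (1 - real N powr (-(\<gamma> + 1)))"
    using assms(3) \<open>\<gamma> + 1 > 0\<close> unfolding with_high_prob_def by blast
  show "\<exists>N0. \<forall>N\<ge>N0. prob_at_least Pr (A N \<inter> B N) (1 - real N powr (-\<gamma>))"
  proof (intro exI allI impI)
    fix N assume N: "N \<ge> max (max N0 N1) 2"
    have "real N powr (-\<gamma>) = real N * real N powr (-(\<gamma> + 1))"
      using N powr_add[of "real N" 1 "-(\<gamma> + 1)"] by simp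
    moreover have "2 * real N powr (-(\<gamma> + 1)) \<le> real N * real N powr (-(\<gamma> + 1))"
      using N by (intro mult_right_mono) auto
    ultimately have "1 - real N powr (-\<gamma>)
        \<le> 1 - real N powr (-(\<gamma> + 1)) + (1 - real N powr (-(\<gamma> + 1))) - 1" by linarith
    moreover have "prob_at_least Pr (A N \<inter> B N)
        (1 - real N powr (-(\<gamma> + 1)) + (1 - real N powr (-(\<gamma> + 1))) - 1)"
      by (rule prob_at_least_Int[OF assms(1) N0 N1]) (use N in auto)
    ultimately show "prob_at_least Pr (A N \<inter> B N) (1 - real N powr (-\<gamma>))"
      by (rule prob_at_least_mono[OF _ subset_refl, rotated])
  qed
qed

text \<open>With \<gamma> = 1 the probability is at least \<open>1 - 1 / N\<close>, which is
  positive for \<open>N \<ge> 2\<close>. One outcome per large \<open>N\<close> suffices for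
  refuting a domination.\<close>

lemma with_high_prob_nonempty:
  assumes "with_high_prob Pr A"
  shows "\<forall>\<^sub>F N in sequentially. A N \<noteq> {}"
proof -
  obtain N0 where N0: "\<And>N. N \<ge> N0 \<Longrightarrow> prob_at_least Pr (A N) (1 - real N powr (-1))"
    using assms[unfolded with_high_prob_def, rule_format, of 1] by auto
  have "A N \<noteq> {}" if N: "N \<ge> max N0 2" for N
  proof
    assume "A N = {}"
    then have "1 - real N powr (-1) \<le> 0"
      using N0[of N] N by (auto simp: prob_at_least_def)
    then show False using N by (simp add: powr_minus_divide divide_simps)
  qed
  then show ?thesis unfolding eventually_sequentially by blast
qed

lemma stoch_dominated_iff_with_high_prob:
  "stoch_dominated Pr U \<xi> \<zeta> \<longleftrightarrow> (\<forall>\<epsilon>>0. with_high_prob Pr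
     (\<lambda>N. {w \<in> space Pr. \<forall>u\<in>U N. \<xi> N u w \<le> ennreal (real N powr \<epsilon>) * \<zeta> N u w}))"
  by (simp add: stoch_dominated_def with_high_prob_def)

subsection \<open>Zeros of perturbed holomorphic functions\<close>

lemma holomorphic_on_det:
  assumes "\<And>z. z \<in> S \<Longrightarrow> A z \<in> carrier_mat n n"
    and "\<And>i j. i < n \<Longrightarrow> j < n \<Longrightarrow> (\<lambda>z. A z $$ (i, j)) holomorphic_on S"
  shows "(\<lambda>z. det (A z)) holomorphic_on S"
proof -
  have p: "p i < n" if "p permutes {0..<n}" "i < n" for p i
    using that permutes_in_image[of p "{0..<n}" i] by auto
  have "(\<lambda>z. \<Sum>p | p permutes {0..<n}. signof p * (\<Prod>i = 0..<n. A z $$ (i, p i))) holomorphic_on S"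
    using p assms(2) by (intro holomorphic_intros) auto
  then show ?thesis
    by (rule holomorphic_transform) (simp add: det_def'[OF assms(1)])
qed

lemma holomorphic_on_resolvent_entry:
  assumes C: "C \<in> carrier_mat n n" and "\<And>z. z \<in> S \<Longrightarrow> poly (det C) z \<noteq> 0" and ij: "i < n" "j < n"
  shows "(\<lambda>z. resolvent C z $$ (i, j)) holomorphic_on S"
proof -
  have "(\<lambda>z. inverse (poly (det C) z) * poly (adj_mat C $$ (i, j)) z) holomorphic_on S"
    using assms(2) by (intro holomorphic_intros) auto
  then show ?thesis
  proof (rule holomorphic_transform)
    fix z assume "z \<in> S"
    have "dim_row (adj_mat C) = n" "dim_col (adj_mat C) = n" using adj_mat(1)[OF C] by auto
    then show "inverse (poly (det C) z) * poly (adj_mat C $$ (i, j)) z = resolvent C z $$ (i, j)"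
      using ij by (simp add: resolvent_eq_adj_mat(1)[OF C assms(2)[OF \<open>z \<in> S\<close>]] mpoly_eval_def)
  qed
qed

text \<open>Near \<open>z0\<close>, \<open>g\<close> is the \<open>k\<close>-th power of
  \<open>z - z0\<close> times a nonvanishing holomorphic factor; \<open>c\<close> is the minimum
  modulus of that factor on a compact disc.\<close>

lemma isolated_zero_lower_bound:
  assumes g: "g holomorphic_on A" and A: "open A" "z0 \<in> A"
    and zero: "isolated_zero g z0" "zorder g z0 = int k"
  obtains r c where "0 < r" "0 < c" "cball z0 r \<subseteq> A"
    "\<And>z. z \<in> cball z0 r \<Longrightarrow> c * cmod (z - z0) ^ k \<le> cmod (g z)"
proof -
  obtain s where s: "s > 0" "ball z0 s \<subseteq> A" using A openE by blast
  have hol: "g holomorphic_on ball z0 s" using g s(2) holomorphic_on_subset by blast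
  have "\<forall>\<^sub>F z in at z0. g z \<noteq> 0" using zero(1) by (simp add: isolated_zero_def)
  moreover have "\<forall>\<^sub>F z in at z0. z \<in> ball z0 s"
    using s(1) by (intro eventually_at_in_open') auto
  ultimately have "\<exists>w\<in>ball z0 s. g w \<noteq> 0"
    using eventually_happens'[OF at_neq_bot eventually_conj] by blast
  then obtain r where r: "r > 0" "cball z0 r \<subseteq> ball z0 s" "zor_poly g z0 holomorphic_on cball z0 r"
      "\<And>w. w \<in> cball z0 r \<Longrightarrow> g w = zor_poly g z0 w * (w - z0) ^ k \<and> zor_poly g z0 w \<noteq> 0"
    using zorder_exist_zero[OF hol open_ball connected_ball, of z0] s(1) zero(2) by auto
  have "continuous_on (cball z0 r) (\<lambda>w. cmod (zor_poly g z0 w))"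
    using r(3) by (intro continuous_on_norm holomorphic_on_imp_continuous_on)
  then obtain x where x: "x \<in> cball z0 r"
      "\<And>w. w \<in> cball z0 r \<Longrightarrow> cmod (zor_poly g z0 x) \<le> cmod (zor_poly g z0 w)"
    using continuous_attains_inf[OF compact_cball, of z0 r "\<lambda>w. cmod (zor_poly g z0 w)"] r(1) by auto
  show thesis
  proof (rule that[OF r(1), of "cmod (zor_poly g z0 x)"])
    show "0 < cmod (zor_poly g z0 x)" using r(4)[OF x(1)] by simp
    show "cball z0 r \<subseteq> A" using r(2) s(2) by auto
    fix z assume z: "z \<in> cball z0 r"
    then have "cmod (g z) = cmod (zor_poly g z0 z) * cmod (z - z0) ^ k"
      using r(4) by (simp add: norm_mult norm_power)
    then show "cmod (zor_poly g z0 x) * cmod (z - z0) ^ k \<le> cmod (g z)"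
      using x(2)[OF z] by (simp add: mult_right_mono)
  qed
qed

text \<open>The global clause yields finitely many zeros in the whole plane, the local one
  holomorphy on the ball. Values at roots of \<open>q\<close> stay free because
  \<open>resolvent\<close> is unspecified at eigenvalues.\<close>

definition quotient_near :: "complex \<Rightarrow> real \<Rightarrow> (complex \<Rightarrow> complex) \<Rightarrow> bool" where
  "quotient_near z0 r f \<longleftrightarrow> (\<exists>p q. (\<forall>z. poly q z \<noteq> 0 \<longrightarrow> f z = poly p z / poly q z) \<and>
     (\<forall>z\<in>ball z0 r. poly q z \<noteq> 0))"

text \<open>On the circle of radius \<rho> the lower bound on \<open>g\<close> exceeds \<delta>,
  which is Rouche's condition; the same bound makes \<open>z0\<close> the only zero of
  \<open>g\<close> in the smaller ball.\<close>

lemma zero_dist_near: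
  assumes g: "g holomorphic_on ball z0 R" "isolated_zero g z0" "zorder g z0 = int k"
    and r: "0 < r" "cball z0 r \<subseteq> ball z0 R"
    and a: "0 < a" "\<And>z. z \<in> cball z0 r \<Longrightarrow> a * cmod (z - z0) ^ k \<le> cmod (g z)"
    and f: "quotient_near z0 R f" "\<And>z. z \<in> ball z0 R \<Longrightarrow> cmod (f z - g z) \<le> \<delta>"
    and \<rho>: "0 < \<rho>" "\<rho> < r" "\<delta> < a * \<rho> ^ k"
  shows "j \<in> {1..k} \<Longrightarrow> zero_dist z0 f j \<le> ennreal \<rho>"
    and "k < j \<Longrightarrow> ennreal \<rho> \<le> zero_dist z0 f j"
proof -
  have "z0 \<in> ball z0 R" using subsetD[OF r(2), of z0] r(1) by simp
  have sub: "ball z0 r \<subseteq> ball z0 R" using r(2) ball_subset_cball by blast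
  have g_ball: "g holomorphic_on ball z0 r"
    by (rule holomorphic_on_subset[OF g(1) sub])
  have "g analytic_on {z0}"
    using g(1) \<open>z0 \<in> ball z0 R\<close> by (meson analytic_at open_ball)
  then have "g z0 = 0"
    using zero_isolated_zero_analytic[OF g(2)] by simp
  have g0: "g z = 0 \<longleftrightarrow> z = z0" if "z \<in> ball z0 r" for z
  proof
    assume "g z = 0"
    then have "a * cmod (z - z0) ^ k \<le> 0" using a(2)[of z] that by simp
    then show "z = z0"
      using a(1) by (metis mult_pos_pos not_le norm_le_zero_iff right_minus_eq zero_less_power)
  qed (use \<open>g z0 = 0\<close> in simp)
  obtain p q where pq: "\<And>z. poly q z \<noteq> 0 \<Longrightarrow> f z = poly p z / poly q z"
      "\<And>z. z \<in> ball z0 R \<Longrightarrow> poly q z \<noteq> 0"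
    using f(1) unfolding quotient_near_def by blast
  have q: "poly q z \<noteq> 0" if "z \<in> ball z0 r" for z
    using pq(2) sub that by blast
  have close: "cmod (f z - g z) < cmod (g z)" if "z \<in> sphere z0 \<rho>" for z
  proof -
    have z: "z \<in> cball z0 r" "cmod (z - z0) = \<rho>"
      using that \<rho> by (auto simp: dist_norm norm_minus_commute)
    have "cmod (f z - g z) \<le> \<delta>" using f(2) z(1) r(2) by blast
    also have "\<dots> < cmod (g z)" using \<rho>(3) a(2)[OF z(1)] z(2) by simp
    finally show ?thesis .
  qed
  show "j \<in> {1..k} \<Longrightarrow> zero_dist z0 f j \<le> ennreal \<rho>"
    and "k < j \<Longrightarrow> ennreal \<rho> \<le> zero_dist z0 f j"
    using zero_dist_quotient[OF pq(1) q g_ball g0 g(3) \<rho>(1,2) close] by blast+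
qed

text \<open>The constant \<open>c\<close> is common to all \<open>e\<close>. Rouche's theorem is
  used on shrinking circles for the first \<open>k\<close> zeros and on a fixed circle for the later
  ones.\<close>

lemma perturbed_zeros:
  fixes F :: "nat \<Rightarrow> 'w \<Rightarrow> complex \<Rightarrow> complex"
  assumes Pr: "prob_space Pr" and k: "k > 0" and \<alpha>: "\<alpha> > 0"
    and g: "g holomorphic_on ball z0 R" "0 < R" "isolated_zero g z0" "zorder g z0 = int k"
    and close: "\<And>e. 0 < e \<Longrightarrow> e < \<alpha> \<Longrightarrow> with_high_prob Pr (\<lambda>N. {w \<in> space Pr. quotient_near z0 R (F N w) \<and>
        (\<forall>z\<in>ball z0 R. cmod (F N w z - g z) \<le> c * real N powr (e - \<alpha>))})"
  shows "j \<in> {1..k} \<Longrightarrow> stoch_dominated Pr (\<lambda>_. {()}) (\<lambda>N _ w. zero_dist z0 (F N w) j)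
            (\<lambda>N _ _. ennreal (real N powr (-\<alpha> / real k)))"
    and "k < j \<Longrightarrow> \<beta> > 0 \<Longrightarrow> \<not> stoch_dominated Pr (\<lambda>_. {()}) (\<lambda>N _ w. zero_dist z0 (F N w) j)
            (\<lambda>N _ _. ennreal (real N powr (-\<beta>)))"
proof -
  have "z0 \<in> ball z0 R" using g(2) by simp
  obtain r a where r: "0 < r" "cball z0 r \<subseteq> ball z0 R" and a: "0 < a"
      "\<And>z. z \<in> cball z0 r \<Longrightarrow> a * cmod (z - z0) ^ k \<le> cmod (g z)"
    by (rule isolated_zero_lower_bound[OF g(1) open_ball \<open>z0 \<in> ball z0 R\<close> g(3,4)]) blast
  note near = zero_dist_near[OF g(1,3,4) r a(1)]
  show "stoch_dominated Pr (\<lambda>_. {()}) (\<lambda>N _ w. zero_dist z0 (F N w) j)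
            (\<lambda>N _ _. ennreal (real N powr (-\<alpha> / real k)))" if j: "j \<in> {1..k}"
    unfolding stoch_dominated_iff_with_high_prob
  proof (intro allI impI)
    fix \<epsilon> :: real assume "\<epsilon> > 0"
    \<comment> \<open>The cap keeps \<open>\<epsilon>' - \<alpha> / k\<close> negative, so that the
      radius \<open>?\<rho> N\<close> tends to 0 and eventually falls below
      \<open>r\<close>.\<close>
    define \<epsilon>' where "\<epsilon>' = min \<epsilon> (\<alpha> / (2 * k))"
    \<comment> \<open>With this \<open>e\<close> the \<open>k\<close>-th power of the radius is
      \<open>N powr (2 * e - \<alpha>)\<close>, larger than the error rate by the factor
      \<open>N powr e\<close>, which eventually absorbs \<open>c / a\<close>.\<close>
    define e where "e = k * \<epsilon>' / 2"
    have "\<alpha> / (2 * k) < \<alpha> / k"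
      using \<alpha> k by (intro divide_strict_left_mono) auto
    then have \<epsilon>': "0 < \<epsilon>'" "\<epsilon>' \<le> \<epsilon>" "\<epsilon>' < \<alpha> / k"
      using \<open>\<epsilon> > 0\<close> \<alpha> k by (auto simp: \<epsilon>'_def)
    have "k * \<epsilon>' < \<alpha>"
      using \<epsilon>'(3) k by (simp add: pos_less_divide_eq mult.commute)
    then have e: "0 < e" "e < \<alpha>"
      using \<epsilon>'(1) k \<alpha> by (auto simp: e_def)
    let ?\<rho> = "\<lambda>N. real N powr (\<epsilon>' - \<alpha> / k)"
    have "(?\<rho> \<longlongrightarrow> 0) sequentially"
      using \<epsilon>'(3) by (intro tendsto_neg_powr filterlim_real_sequentially) auto
    then have ev1: "\<forall>\<^sub>F N in sequentially. ?\<rho> N < r"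
      using r(1) by (rule order_tendstoD)
    have "((\<lambda>N. c * real N powr (-e)) \<longlongrightarrow> c * 0) sequentially"
      using e by (intro tendsto_mult tendsto_const tendsto_neg_powr filterlim_real_sequentially) auto
    then have ev2: "\<forall>\<^sub>F N in sequentially. c * real N powr (-e) < a"
      using a(1) by (intro order_tendstoD(2)) auto
    have ev3: "\<forall>\<^sub>F N in sequentially. N \<ge> (1::nat)" by (rule eventually_ge_at_top)
    show "with_high_prob Pr (\<lambda>N. {w \<in> space Pr. \<forall>u\<in>{()}. zero_dist z0 (F N w) j
        \<le> ennreal (real N powr \<epsilon>) * ennreal (real N powr (-\<alpha> / real k))})"
    proof (rule with_high_prob_mono[OF close[OF e]], use ev1 ev2 ev3 in eventually_elim)
      case (elim N)
      have "c * real N powr (e - \<alpha>) = c * real N powr (-e) * real N powr (2 * e - \<alpha>)"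
        by (simp flip: powr_add)
      also have "\<dots> < a * real N powr (2 * e - \<alpha>)"
        using elim by (intro mult_strict_right_mono) auto
      also have "real N powr (2 * e - \<alpha>) = ?\<rho> N ^ k"
      proof -
        have "2 * e - \<alpha> = (\<epsilon>' - \<alpha> / k) * k" using k by (simp add: e_def field_simps)
        then show ?thesis using elim(3) by (simp add: powr_power mult.commute)
      qed
      finally have small: "c * real N powr (e - \<alpha>) < a * ?\<rho> N ^ k" .
      have "?\<rho> N \<le> real N powr (\<epsilon> + (-\<alpha> / k))"
        using elim \<epsilon>'(2) by (intro powr_mono) auto
      then have "ennreal (?\<rho> N) \<le> ennreal (real N powr \<epsilon>) * ennreal (real N powr (-\<alpha> / real k))"
        unfolding powr_add by (simp add: ennreal_leI flip: ennreal_mult')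
      moreover have "zero_dist z0 (F N w) j \<le> ennreal (?\<rho> N)"
        if "quotient_near z0 R (F N w)" "\<forall>z\<in>ball z0 R. cmod (F N w z - g z) \<le> c * real N powr (e - \<alpha>)" for w
        by (rule near(1)[where \<delta> = "c * real N powr (e - \<alpha>)"]) (use a(2) that elim small j in auto)
      ultimately show ?case by (auto intro: order_trans)
    qed
  qed
  show "\<not> stoch_dominated Pr (\<lambda>_. {()}) (\<lambda>N _ w. zero_dist z0 (F N w) j)
            (\<lambda>N _ _. ennreal (real N powr (-\<beta>)))" if j: "k < j" and \<beta>: "\<beta> > 0"
  proof
    assume "stoch_dominated Pr (\<lambda>_. {()}) (\<lambda>N _ w. zero_dist z0 (F N w) j)
            (\<lambda>N _ _. ennreal (real N powr (-\<beta>)))"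
    \<comment> \<open>Domination with loss \<open>\<beta> / 2\<close> would put the
      \<open>j\<close>-th zero within \<open>N powr (- \<beta> / 2)\<close> of \<open>z0\<close>,
      whereas Rouche on the circle of radius \<open>r / 2\<close> keeps it outside.\<close>
    then have dom: "with_high_prob Pr (\<lambda>N. {w \<in> space Pr. \<forall>u\<in>{()}. zero_dist z0 (F N w) j
        \<le> ennreal (real N powr (\<beta> / 2)) * ennreal (real N powr (-\<beta>))})"
      using \<beta> unfolding stoch_dominated_iff_with_high_prob by (meson half_gt_zero)
    \<comment> \<open>Any admissible loss would do here: the error only has to tend to 0 while the
      circle is fixed.\<close>
    have e: "0 < \<alpha> / 2" "\<alpha> / 2 < \<alpha>" using \<alpha> by auto
    have ev1: "\<forall>\<^sub>F N in sequentially. c * real N powr (\<alpha> / 2 - \<alpha>) < a * (r / 2) ^ k"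
    proof (rule order_tendstoD(2))
      have "((\<lambda>N. c * real N powr (\<alpha> / 2 - \<alpha>)) \<longlongrightarrow> c * 0) sequentially"
        using \<alpha> by (intro tendsto_mult tendsto_const tendsto_neg_powr filterlim_real_sequentially) auto
      then show "((\<lambda>N. c * real N powr (\<alpha> / 2 - \<alpha>)) \<longlongrightarrow> 0) sequentially" by simp
      show "0 < a * (r / 2) ^ k" using a(1) r(1) by simp
    qed
    have "((\<lambda>N. real N powr (- \<beta> / 2)) \<longlongrightarrow> 0) sequentially"
      using \<beta> by (intro tendsto_neg_powr filterlim_real_sequentially) auto
    then have ev2: "\<forall>\<^sub>F N in sequentially. real N powr (- \<beta> / 2) < r / 2"
      using r(1) by (intro order_tendstoD(2)) auto
    have "\<forall>\<^sub>F N in sequentially. False"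
      using ev1 ev2 with_high_prob_nonempty[OF with_high_prob_Int[OF Pr dom close[OF e]]]
    proof eventually_elim
      case (elim N)
      then obtain w where w: "zero_dist z0 (F N w) j
            \<le> ennreal (real N powr (\<beta> / 2)) * ennreal (real N powr (-\<beta>))"
          "quotient_near z0 R (F N w)"
          "\<forall>z\<in>ball z0 R. cmod (F N w z - g z) \<le> c * real N powr (\<alpha> / 2 - \<alpha>)"
        by auto
      have "ennreal (r / 2) \<le> zero_dist z0 (F N w) j"
        by (rule near(2)[where \<delta> = "c * real N powr (\<alpha> / 2 - \<alpha>)"]) (use a(2) w r elim j in auto)
      also have "\<dots> \<le> ennreal (real N powr (\<beta> / 2) * real N powr (-\<beta>))"
        using w(1) by (simp add: ennreal_mult')
      also have "real N powr (\<beta> / 2) * real N powr (-\<beta>) = real N powr (- \<beta> / 2)"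
        by (simp flip: powr_add)
      finally show False using elim(2) r(1) by (simp add: ennreal_le_iff)
    qed
    then show False by simp
  qed
qed

subsection \<open>Zeros of the determinant\<close>

theorem theorem14:
  fixes Pr :: "'w measure"
    and n d k :: nat
    and C :: "complex poly mat"
    and P Q :: "nat \<Rightarrow> complex mat"
    and A :: "nat \<Rightarrow> complex poly mat"
    and X :: "nat \<Rightarrow> 'w \<Rightarrow> complex poly mat"
    and M :: "nat \<Rightarrow> complex \<Rightarrow> complex mat"
    and S :: "nat \<Rightarrow> complex set"
    and \<Psi> :: "nat \<Rightarrow> complex \<Rightarrow> ennreal"
    and G K :: "complex \<Rightarrow> complex mat"
    and L :: "nat \<Rightarrow> 'w \<Rightarrow> complex \<Rightarrow> complex mat"
    and \<alpha> :: real
    and z0 :: complex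
  assumes "prob_space Pr"
    and "C \<in> carrier_mat n n"
    and "\<And>N. N \<ge> 1 \<Longrightarrow> P N \<in> carrier_mat N n"
    and "\<And>N. N \<ge> 1 \<Longrightarrow> Q N \<in> carrier_mat n N"
    and "\<And>N. A N = mpoly_const (P N) * C * mpoly_const (Q N)"
    and "random_mpoly Pr d X"
    and a1: "has_limit_law Pr X M S \<Psi>"
    and a2_1: "\<And>z. z \<in> (\<Union>N\<in>{1..}. S N) \<Longrightarrow> invertible_mat (mpoly_eval C z)"
    and a3_1: "\<alpha> > 0"
      "\<exists>c. \<forall>\<^sub>F N in sequentially. (SUP z\<in>S N. \<Psi> N z) \<le> ennreal (c * real N powr (-\<alpha>))"
    and a4: "\<exists>c. \<forall>N\<ge>1. mat_norm2 (P N) \<le> c \<and> mat_norm2 (Q N) \<le> c \<and>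
      real (col_nonzeros (P N)) \<le> c \<and> real (row_nonzeros (Q N)) \<le> c"
    \<comment> \<open>\<open>G\<close> is the common value of the functions \<open>z \<mapsto> Q\<^sub>N M\<^sub>N(z) P\<^sub>N\<close>, each defined on \<open>S\<^sub>N\<close>\<close>
    and a5_1: "\<And>N z. N \<ge> 1 \<Longrightarrow> z \<in> S N \<Longrightarrow> Q N * M N z * P N = G z"
      "\<And>i j. i < n \<Longrightarrow> j < n \<Longrightarrow> (\<lambda>z. G z $$ (i, j)) analytic_on interior (\<Union>N\<in>{1..}. S N)"
    and K_def: "\<And>z. K z = resolvent C z + G z"
    and L_def: "\<And>N w z. L N w z = resolvent C z + Q N * resolvent (X N w) z * P N"
    and "k > 0"
    and "z0 \<in> interior (\<Union>N\<in>{1..}. S N)"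
    and "isolated_zero (\<lambda>z. det (K z)) z0" "zorder (\<lambda>z. det (K z)) z0 = int k"
  shows "(\<forall>j\<in>{1..k}. stoch_dominated Pr (\<lambda>_. {()})
            (\<lambda>N _ w. zero_dist z0 (\<lambda>z. det (L N w z)) j)
            (\<lambda>N _ _. ennreal (real N powr (-\<alpha> / real k))))
       \<and> (\<forall>\<beta>>0. \<forall>j\<ge>k + 1. \<not> stoch_dominated Pr (\<lambda>_. {()})
            (\<lambda>N _ w. zero_dist z0 (\<lambda>z. det (L N w z)) j)
            (\<lambda>N _ _. ennreal (real N powr (-\<beta>))))"
proof -

  \<comment> \<open>A disc around \<open>z0\<close> with bounds uniform in \<open>N\<close>\<close>
  define U where "U = (\<Union>N\<in>{1..}. S N)"
  have S_open: "open (S N)" and S_Suc: "S N \<subseteq> S (Suc N)"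
    and M_car: "z \<in> S N \<Longrightarrow> M N z \<in> carrier_mat N N" if "N \<ge> 1" for N z
    using a1 that unfolding has_limit_law_def by blast+
  have no_ev: "with_high_prob Pr (\<lambda>N. {w \<in> space Pr. \<forall>z\<in>S N. \<not> mpoly_eigenvalue (X N w) z})"
    and res: "stoch_dominated Pr S
       (\<lambda>N z w. ennreal (mat_norm_max (resolvent (X N w) z - M N z))) (\<lambda>N z w. \<Psi> N z)"
    using a1 unfolding has_limit_law_def by blast+
  have X_car: "X N w \<in> carrier_mat N N" if "N \<ge> 1" "w \<in> space Pr" for N w
    using \<open>random_mpoly Pr d X\<close> that unfolding random_mpoly_def by blast
  note C_car = \<open>C \<in> carrier_mat n n\<close> and P_car = assms(3) and Q_car = assms(4)
  have detC: "poly (det C) z \<noteq> 0" if "z \<in> U" for z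
    using invertible_mpoly_eval_imp_det[OF C_car a2_1] that by (simp add: U_def)
  have "z0 \<in> U" using assms(17) interior_subset unfolding U_def by blast
  \<comment> \<open>One open set \<open>S N1\<close> already contains a closed disc around
    \<open>z0\<close>; by monotonicity the disc then lies in \<open>S N\<close> for all
    \<open>N \<ge> N1\<close>.\<close>
  then obtain N1 where N1: "N1 \<ge> 1" "z0 \<in> S N1" by (auto simp: U_def)
  then obtain R where R: "R > 0" "cball z0 R \<subseteq> S N1"
    using S_open open_contains_cball by meson
  have mono: "S N1 \<subseteq> S N" if "N \<ge> N1" for N
    using that
  proof (induction N rule: dec_induct)
    case (step m)
    then show ?case using S_Suc[of m] N1(1) by auto
  qed simp
  have SU: "S N1 \<subseteq> U" using N1(1) by (auto simp: U_def)
  have G_car: "G z \<in> carrier_mat n n" if "z \<in> S N1" for z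
    using a5_1(1)[OF N1(1) that, symmetric] M_car[OF N1(1) that] P_car[OF N1(1)] Q_car[OF N1(1)]
    by (simp add: mult_carrier_mat[of _ n N1])
  have rC_car: "resolvent C z \<in> carrier_mat n n" if "z \<in> S N1" for z
    using resolvent_eq_adj_mat(2)[OF C_car detC] SU that by blast
  have K_car: "K z \<in> carrier_mat n n" if "z \<in> S N1" for z
    unfolding K_def by (rule add_carrier_mat[OF G_car[OF that]])
  have K_hol: "(\<lambda>z. K z $$ (i, j)) holomorphic_on S N1" if ij: "i < n" "j < n" for i j
  proof -
    have "S N1 \<subseteq> interior (\<Union>N\<in>{1..}. S N)"
      using SU S_open[OF N1(1)] by (intro interior_maximal) (auto simp: U_def)
    then have "(\<lambda>z. G z $$ (i, j)) holomorphic_on S N1"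
      using a5_1(2)[OF ij] analytic_on_subset analytic_imp_holomorphic by blast
    moreover have "(\<lambda>z. resolvent C z $$ (i, j)) holomorphic_on S N1"
      using holomorphic_on_resolvent_entry[OF C_car _ ij] detC SU by blast
    ultimately have "(\<lambda>z. resolvent C z $$ (i, j) + G z $$ (i, j)) holomorphic_on S N1"
      by (intro holomorphic_intros)
    then show ?thesis
    proof (rule holomorphic_transform)
      fix z assume "z \<in> S N1"
      then show "resolvent C z $$ (i, j) + G z $$ (i, j) = K z $$ (i, j)"
        using ij carrier_matD[OF G_car] carrier_matD[OF rC_car] by (simp add: K_def)
    qed
  qed
  have detK_hol: "(\<lambda>z. det (K z)) holomorphic_on ball z0 R"
    using holomorphic_on_det[OF K_car K_hol] R(2) ball_subset_cball
    by (meson holomorphic_on_subset order_trans)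
  \<comment> \<open>Compactness of the closed disc bounds all entries of \<open>K\<close> by a
    single \<open>B\<close>.\<close>
  have "continuous_on (cball z0 R) (\<lambda>z. \<Sum>i<n. \<Sum>j<n. cmod (K z $$ (i, j)))"
    by (intro continuous_intros)
      (auto intro!: continuous_on_subset[OF holomorphic_on_imp_continuous_on[OF K_hol] R(2)])
  then have "bounded ((\<lambda>z. \<Sum>i<n. \<Sum>j<n. cmod (K z $$ (i, j))) ` cball z0 R)"
    by (intro compact_imp_bounded compact_continuous_image) auto
  then obtain B where B: "\<forall>z\<in>cball z0 R. \<bar>\<Sum>i<n. \<Sum>j<n. cmod (K z $$ (i, j))\<bar> \<le> B"
    by (auto simp: bounded_iff)
  have K_bound: "cmod (K z $$ (i, j)) \<le> B" if "z \<in> cball z0 R" "i < n" "j < n" for z i j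
  proof -
    have "cmod (K z $$ (i, j)) \<le> (\<Sum>j<n. cmod (K z $$ (i, j)))"
      using that(3) by (intro member_le_sum) auto
    also have "\<dots> \<le> (\<Sum>i<n. \<Sum>j<n. cmod (K z $$ (i, j)))"
      using that(2) by (intro member_le_sum[of _ _ "\<lambda>i. \<Sum>j<n. cmod (K z $$ (i, j))"]) (auto intro: sum_nonneg)
    finally show ?thesis using bspec[OF B that(1)] by linarith
  qed
  have "B \<ge> 0" using bspec[OF B, of z0] R(1) by auto
  obtain c0 where c0: "\<And>N. N \<ge> 1 \<Longrightarrow> mat_norm2 (P N) \<le> c0 \<and> mat_norm2 (Q N) \<le> c0 \<and>
      real (col_nonzeros (P N)) \<le> c0 \<and> real (row_nonzeros (Q N)) \<le> c0"
    using a4 by blast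
  have "c0 \<ge> 0" using c0[of 1] of_nat_0_le_iff order_trans by blast
  obtain c1 where "\<forall>\<^sub>F N in sequentially. (SUP z\<in>S N. \<Psi> N z) \<le> ennreal (c1 * real N powr (-\<alpha>))"
    using a3_1(2) by blast
  \<comment> \<open>\<open>c1\<close> may be negative, where \<open>ennreal\<close> truncates to 0;
    a nonnegative constant lets the bound be read back in the reals.\<close>
  moreover define c2 where "c2 = max c1 0"
  have "ennreal (c1 * real N powr (-\<alpha>)) \<le> ennreal (c2 * real N powr (-\<alpha>))" for N
    by (intro ennreal_leI mult_right_mono) (auto simp: c2_def)
  ultimately have \<Psi>_bound: "\<forall>\<^sub>F N in sequentially. \<forall>z\<in>S N. \<Psi> N z \<le> ennreal (c2 * real N powr (-\<alpha>))"
    by (elim eventually_mono) (meson SUP_upper order_trans)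
  have "c2 \<ge> 0" by (simp add: c2_def)
  define \<kappa> where "\<kappa> = c0 ^ 4 * c2"
  have "\<kappa> \<ge> 0" using \<open>c0 \<ge> 0\<close> \<open>c2 \<ge> 0\<close> by (simp add: \<kappa>_def)
  \<comment> \<open>The constant of \<open>norm_det_diff_le\<close>: entries of \<open>K\<close> are
    at most \<open>B\<close>, those of \<open>L\<close> at most \<open>B + \<kappa>\<close>, and the
    added 1 secures a base of at least 1. Neither \<open>e\<close> nor \<open>N\<close>
    enters.\<close>
  define c where "c = fact n * real n * (B + \<kappa> + 1) ^ n * \<kappa>"

  \<comment> \<open>Closeness of the two determinants on the disc\<close>
  have close: "with_high_prob Pr (\<lambda>N. {w \<in> space Pr. quotient_near z0 R (\<lambda>z. det (L N w z)) \<and>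
        (\<forall>z\<in>ball z0 R. cmod (det (L N w z) - det (K z)) \<le> c * real N powr (e - \<alpha>))})"
    if e: "0 < e" "e < \<alpha>" for e
  proof -
    have "with_high_prob Pr (\<lambda>N. {w \<in> space Pr. \<forall>z\<in>S N.
        ennreal (mat_norm_max (resolvent (X N w) z - M N z)) \<le> ennreal (real N powr e) * \<Psi> N z})"
      using res e(1) unfolding stoch_dominated_iff_with_high_prob by blast
    note high = with_high_prob_Int[OF \<open>prob_space Pr\<close> no_ev this]
    show ?thesis
    proof (rule with_high_prob_mono[OF high])
      show "\<forall>\<^sub>F N in sequentially.
          {w \<in> space Pr. \<forall>z\<in>S N. \<not> mpoly_eigenvalue (X N w) z} \<inter>
          {w \<in> space Pr. \<forall>z\<in>S N. ennreal (mat_norm_max (resolvent (X N w) z - M N z))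
             \<le> ennreal (real N powr e) * \<Psi> N z}
        \<subseteq> {w \<in> space Pr. quotient_near z0 R (\<lambda>z. det (L N w z)) \<and>
          (\<forall>z\<in>ball z0 R. cmod (det (L N w z) - det (K z)) \<le> c * real N powr (e - \<alpha>))}"
        using eventually_ge_at_top[of N1] \<Psi>_bound
      proof eventually_elim
        case (elim N)
        note N = elim(1) and \<Psi> = elim(2)
        show ?case
        proof
          fix w
          assume w: "w \<in> {w \<in> space Pr. \<forall>z\<in>S N. \<not> mpoly_eigenvalue (X N w) z} \<inter>
            {w \<in> space Pr. \<forall>z\<in>S N. ennreal (mat_norm_max (resolvent (X N w) z - M N z))
               \<le> ennreal (real N powr e) * \<Psi> N z}"
          have N_ge: "N \<ge> 1" using N N1(1) by simp
          have X: "X N w \<in> carrier_mat N N" using X_car[OF N_ge] w by blast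
          note P = P_car[OF N_ge] and Q = Q_car[OF N_ge]
          have in_S: "z \<in> S N" "z \<in> S N1" "z \<in> cball z0 R" if "z \<in> ball z0 R" for z
            using that R(2) mono[OF N] ball_subset_cball by blast+
          have detX: "poly (det (X N w)) z \<noteq> 0" if "z \<in> ball z0 R" for z
            using not_mpoly_eigenvalue_iff[OF X] w in_S(1)[OF that] by blast
          have "quotient_near z0 R (\<lambda>z. det (L N w z))"
          proof -
            let ?q = "(det C * det (X N w)) ^ n"
            obtain p where p: "\<And>z. poly ?q z \<noteq> 0 \<Longrightarrow> det (L N w z) = poly p z / poly ?q z"
              using det_resolvent_add_quotient[OF C_car X Q P] unfolding L_def by blast
            have "poly ?q z \<noteq> 0" if "z \<in> ball z0 R" for z
              using detX[OF that] detC in_S(2)[OF that] SU by auto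
            with p show ?thesis unfolding quotient_near_def by blast
          qed
          moreover have "cmod (det (L N w z) - det (K z)) \<le> c * real N powr (e - \<alpha>)" if z: "z \<in> ball z0 R" for z
          proof -
            let ?m = "mat_norm_max (resolvent (X N w) z - M N z)"
            note zS = in_S[OF z]
            have rX: "resolvent (X N w) z \<in> carrier_mat N N" by (rule resolvent_eq_adj_mat(2)[OF X detX[OF z]])
            have M: "M N z \<in> carrier_mat N N" by (rule M_car[OF N_ge zS(1)])
            have "ennreal ?m \<le> ennreal (real N powr e) * \<Psi> N z"
              using w zS(1) by blast
            also have "\<dots> \<le> ennreal (real N powr e) * ennreal (c2 * real N powr (-\<alpha>))"
              using \<Psi> zS(1) by (intro mult_left_mono) auto
            also have "\<dots> = ennreal (real N powr e * (c2 * real N powr (-\<alpha>)))"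
              by (simp add: ennreal_mult')
            also have "real N powr e * (c2 * real N powr (-\<alpha>)) = c2 * real N powr (e - \<alpha>)"
              by (simp add: powr_diff powr_minus field_simps)
            finally have m: "?m \<le> c2 * real N powr (e - \<alpha>)"
              using \<open>c2 \<ge> 0\<close> by (simp add: ennreal_le_iff)
            define \<delta> where "\<delta> = \<kappa> * real N powr (e - \<alpha>)"
            have QXP: "Q N * resolvent (X N w) z * P N \<in> carrier_mat n n"
              by (rule mult_carrier_mat[OF mult_carrier_mat[OF Q rX] P])
            have QMP: "Q N * M N z * P N \<in> carrier_mat n n"
              by (rule mult_carrier_mat[OF mult_carrier_mat[OF Q M] P])
            \<comment> \<open>The summand \<open>resolvent C z\<close> cancels in the difference of
              \<open>L\<close> and \<open>K\<close>, so only the sandwiched error of the limit law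
              remains.\<close>
            have diff: "Q N * (resolvent (X N w) z - M N z) * P N
                = Q N * resolvent (X N w) z * P N - Q N * M N z * P N"
              unfolding mult_minus_distrib_mat[OF Q rX M]
              by (rule minus_mult_distrib_mat[OF mult_carrier_mat[OF Q rX] mult_carrier_mat[OF Q M] P])
            have entry: "cmod (L N w z $$ (i, j) - K z $$ (i, j)) \<le> \<delta>" if ij: "i < n" "j < n" for i j
            proof -
              have "L N w z $$ (i, j) - K z $$ (i, j)
                  = (Q N * resolvent (X N w) z * P N) $$ (i, j) - (Q N * M N z * P N) $$ (i, j)"
                unfolding L_def K_def a5_1(1)[OF N_ge zS(1), symmetric]
                using ij carrier_matD[OF QXP] carrier_matD[OF QMP] by (simp del: index_mult_mat assoc_mult_mat)
              also have "\<dots> = (Q N * (resolvent (X N w) z - M N z) * P N) $$ (i, j)"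
                unfolding diff using ij carrier_matD[OF QMP] by (simp del: index_mult_mat assoc_mult_mat)
              also have "cmod \<dots> \<le> c0 ^ 4 * ?m"
                using c0[OF N_ge] \<open>c0 \<ge> 0\<close> ij M by (intro norm_sandwich_entry_le[OF Q _ P]) auto
              also have "\<dots> \<le> c0 ^ 4 * (c2 * real N powr (e - \<alpha>))"
                using m \<open>c0 \<ge> 0\<close> by (intro mult_left_mono) auto
              finally show ?thesis by (simp add: \<delta>_def \<kappa>_def mult.assoc)
            qed
            \<comment> \<open>Since \<open>e < \<alpha>\<close>, the entrywise error is at most
              \<kappa>, and the entries of \<open>L\<close> inherit a bound from those of
              \<open>K\<close>.\<close>
            have "real N powr (e - \<alpha>) \<le> 1"
              using N_ge e(2) powr_mono[of "e - \<alpha>" 0 "real N"] by simp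
            then have \<delta>: "0 \<le> \<delta>" "\<delta> \<le> \<kappa>"
              using \<open>\<kappa> \<ge> 0\<close> by (auto simp: \<delta>_def mult_left_le)
            have K_le: "cmod (K z $$ (i, j)) \<le> B + \<kappa> + 1" if "i < n" "j < n" for i j
              using K_bound[OF zS(3) that] \<open>\<kappa> \<ge> 0\<close> by simp
            have L_le: "cmod (L N w z $$ (i, j)) \<le> B + \<kappa> + 1" if "i < n" "j < n" for i j
              using norm_triangle_sub[of "L N w z $$ (i, j)" "K z $$ (i, j)"]
                K_bound[OF zS(3) that] entry[OF that] \<delta> by linarith
            have L_car: "L N w z \<in> carrier_mat n n" unfolding L_def by (rule add_carrier_mat[OF QXP])
            have "cmod (det (L N w z) - det (K z)) \<le> fact n * real n * (B + \<kappa> + 1) ^ n * \<delta>"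
              by (rule norm_det_diff_le[OF L_car K_car[OF zS(2)] L_le K_le entry])
                (use \<delta> \<open>B \<ge> 0\<close> \<open>\<kappa> \<ge> 0\<close> in auto)
            then show ?thesis by (simp add: c_def \<delta>_def mult.assoc)
          qed
          ultimately show "w \<in> {w \<in> space Pr. quotient_near z0 R (\<lambda>z. det (L N w z)) \<and>
              (\<forall>z\<in>ball z0 R. cmod (det (L N w z) - det (K z)) \<le> c * real N powr (e - \<alpha>))}"
            using w by blast
        qed
      qed
    qed
  qed
  note zeros = perturbed_zeros[OF \<open>prob_space Pr\<close> \<open>k > 0\<close> \<open>\<alpha> > 0\<close> detK_hol R(1) assms(18,19) close]
  show ?thesis
    using zeros by (auto simp: Suc_le_eq)
qed

end
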